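(* Let $p>1$, $q=p^{-1}$, and $-1<N,D<1$, and let $$a_n=\frac{p^n+N}{p^n+D},\qquad n\ge 0.$$ The sequence $(a_n)_{n\ge 0}$ is interpolated by a Bernstein function if and only if $$N=D\qquad\text{or}\qquad\bigl(N<D\ \text{and}\ D\le 0\bigr).$$ Precisely: (i) if $N=D$, then $a_n\equiv 1$ and $F\equiv 1$ interpolates; (ii) if $N<D\le 0$, then $$F(x)=\frac{1+Nq^{x}}{1+Dq^{x}},\qquad x>0,$$ is a Bernstein interpolant: with $c=\log p$ and $u=e^{-cx}$, $$F'(x)=c\,(D-N)\,\frac{u}{(1+Du)^2}=c\,(D-N)\sum_{m\ge 1}m\,(-D)^{m-1}e^{-mcx},$$ a convergent series with nonnegative coefficients, so $F'$ is completely monotone; (iii) if $N<D$ and $0<D<1$, no Bernstein function interpolates $(a_n)$: the increments $d_n=a_{n+1}-a_n$ have the unique signed Hausdorff representation $$d_n=(D-N)\sum_{m\ge 1}(1-q^m)(-D)^{m-1}q^{mn},\qquad n\ge 0,$$ whose atom at $q^2$ has mass $-(D-N)D(1-q^2)<0$; (iv) if $N>D$, the sequence is strictly decreasing and therefore has no Bernstein interpolant.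
   Context: A function $f:(0,\infty)\to[0,\infty)$ is completely monotone if $f\in C^\infty$ and $(-1)^n f^{(n)}(x)\ge 0$ for all $n\ge 0$, $x>0$. A function $F:(0,\infty)\to[0,\infty)$ is a Bernstein function if $F\in C^\infty$ and $F'$ is completely monotone. A Bernstein function $F$ interpolates $(a_n)_{n\ge 0}$ if $F(n)=a_n$ for all integers $n\ge 0$, where $F(0)$ is understood as the finite limit $F(0^+)$. A signed Hausdorff representation of a sequence $(d_n)_{n\ge 0}$ is a finite signed Borel measure $\sigma$ on $[0,1]$ with $d_n=\int_{[0,1]}s^n\,d\sigma(s)$ for all $n\ge 0$; in (iii) this measure is $\sigma=(D-N)\sum_{m\ge 1}(1-q^m)(-D)^{m-1}\delta_{q^m}$. *)

theory Defs
  imports "HOL-Analysis.Analysis"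
begin

text \<open>Functions on \<open>(0,\<infinity>)\<close> are represented by total functions on the reals. Only their values
  at positive arguments matter below: \<open>(0,\<infinity>)\<close> is open, so derivatives at \<open>x > 0\<close> are unaffected
  by values elsewhere.\<close>

definition smooth_pos :: "(real \<Rightarrow> real) \<Rightarrow> bool" where
  "smooth_pos f \<longleftrightarrow> (\<forall>n. \<forall>x>0. (deriv ^^ n) f differentiable (at x))"

text \<open>Nonnegativity of \<open>f\<close> itself is the case \<open>n = 0\<close>.\<close>

definition completely_monotone :: "(real \<Rightarrow> real) \<Rightarrow> bool" where
  "completely_monotone f \<longleftrightarrow>
     smooth_pos f \<and> (\<forall>n. \<forall>x>0. (-1) ^ n * (deriv ^^ n) f x \<ge> 0)"

definition bernstein_function :: "(real \<Rightarrow> real) \<Rightarrow> bool" where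
  "bernstein_function F \<longleftrightarrow>
     (\<forall>x>0. F x \<ge> 0) \<and> smooth_pos F \<and> completely_monotone (deriv F)"

text \<open>The value at \<open>0\<close> is read as the right limit, not as the value of the total function at \<open>0\<close>.\<close>

definition bernstein_interpolant :: "(real \<Rightarrow> real) \<Rightarrow> (nat \<Rightarrow> real) \<Rightarrow> bool" where
  "bernstein_interpolant F a \<longleftrightarrow>
     bernstein_function F \<and> (F \<longlongrightarrow> a 0) (at_right 0) \<and> (\<forall>n\<ge>1. F (real n) = a n)"

text \<open>A finite signed measure on the measurable space underlying \<open>M\<close>: a real-valued countably
  additive function on \<open>sets M\<close> (its values outside \<open>sets M\<close> are irrelevant).\<close>

definition signed_measure :: "'a measure \<Rightarrow> ('a set \<Rightarrow> real) \<Rightarrow> bool" where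
  "signed_measure M \<sigma> \<longleftrightarrow>
     \<sigma> {} = 0 \<and>
     (\<forall>A::nat \<Rightarrow> 'a set. range A \<subseteq> sets M \<longrightarrow> disjoint_family A \<longrightarrow>
        (\<lambda>i. \<sigma> (A i)) sums \<sigma> (\<Union>i. A i))"

text \<open>The positive and negative variations of the Jordan decomposition. Coercion to \<open>ennreal\<close> sends
  negative numbers to \<open>0\<close>, which does not change the supremum because \<open>B = {}\<close> contributes \<open>0\<close>.
  For a signed measure these set functions are (finite) measures.\<close>

definition positive_variation :: "'a measure \<Rightarrow> ('a set \<Rightarrow> real) \<Rightarrow> 'a measure" where
  "positive_variation M \<sigma> =
     measure_of (space M) (sets M) (\<lambda>A. SUP B\<in>{B \<in> sets M. B \<subseteq> A}. ennreal (\<sigma> B))"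

definition negative_variation :: "'a measure \<Rightarrow> ('a set \<Rightarrow> real) \<Rightarrow> 'a measure" where
  "negative_variation M \<sigma> = positive_variation M (\<lambda>A. - \<sigma> A)"

definition signed_integral :: "'a measure \<Rightarrow> ('a set \<Rightarrow> real) \<Rightarrow> ('a \<Rightarrow> real) \<Rightarrow> real" where
  "signed_integral M \<sigma> f =
     (LINT s|positive_variation M \<sigma>. f s) - (LINT s|negative_variation M \<sigma>. f s)"

abbreviation borel_unit :: "real measure" where
  "borel_unit \<equiv> restrict_space borel {0..1}"

definition signed_hausdorff_rep :: "(real set \<Rightarrow> real) \<Rightarrow> (nat \<Rightarrow> real) \<Rightarrow> bool" where
  "signed_hausdorff_rep \<sigma> d \<longleftrightarrow>
     signed_measure borel_unit \<sigma> \<and> (\<forall>n. d n = signed_integral borel_unit \<sigma> (\<lambda>s. s ^ n))"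

end

theory Submission
  imports Defs "HOL-Computational_Algebra.Polynomial"
begin

text \<open>
  Write \<open>u = e\<^sup>-\<^sup>c\<^sup>x\<close> with \<open>c = ln p\<close>. The candidate interpolant is an affine function of
  \<open>v = u / (1 + D u)\<close>, and \<open>v\<close> solves the logistic equation \<open>v' = - c (v - D v\<^sup>2)\<close>. For \<open>D \<le> 0\<close>
  the right-hand side is minus a polynomial in \<open>v\<close> with nonnegative coefficients, so differentiating
  such a polynomial of \<open>v\<close> again gives minus such a polynomial of \<open>v\<close>. The signs of all derivatives
  then alternate (\<open>bernstein_function_mobius_exp\<close>), without differentiating any series.

  In the other direction, the mean value theorem shows that the increments \<open>G(n+1) - G(n)\<close>, \<open>n \<ge> 1\<close>, of a
  Bernstein function have nonnegative iterated backward differences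
  (\<open>bernstein_function_increments_totally_monotone\<close>). If the increments are the moments
  \<open>L(s\<^sup>n)\<close> of a functional \<open>L\<close> on \<open>C[0,1]\<close>, these differences are the values \<open>L(s\<^sup>n (1-s)\<^sup>k)\<close>, and
  approximation by Bernstein polynomials makes \<open>L\<close> a positive functional
  (\<open>totally_monotone_functional_nonneg\<close>). A tent function around an isolated atom then forces its mass
  to be nonnegative. For \<open>0 < D\<close> the atom at \<open>q\<^sup>2\<close> has negative mass, so there is no interpolant.
  For \<open>N > D\<close> there is none because Bernstein functions are nondecreasing.

  The same positivity principle, applied to the difference of two functionals with equal moments
  and to its negative, shows that they agree on \<open>C[0,1]\<close>. Since a signed measure is the difference
  of its two variations, which are finite measures (\<open>jordan_decomposition\<close>), dominated convergence passes
  from continuous functions to intervals and Dynkin's lemma to all Borel sets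
  (\<open>signed_hausdorff_rep_unique\<close>). That the discrete measure of the theorem represents the
  increments is the geometric series, together with the fact that a signed integral may be
  computed from any decomposition into two finite measures
  (\<open>signed_integral_diff_finite_measures\<close>).
\<close>

section \<open>Iterated derivatives on the positive half-line\<close>

text \<open>A candidate for the sequence of all derivatives of a function on \<open>(0,\<infinity>)\<close>. Giving the
  sequence explicitly avoids the function \<open>deriv\<close>, whose iterates are known only on \<open>(0,\<infinity>)\<close>.\<close>

definition derivative_chain :: "(nat \<Rightarrow> real \<Rightarrow> real) \<Rightarrow> bool" where
  "derivative_chain g \<longleftrightarrow> (\<forall>n. \<forall>x>0. (g n has_real_derivative g (Suc n) x) (at x))"

lemma eventually_pos_nhds: "x > 0 \<Longrightarrow> (\<And>y. y > 0 \<Longrightarrow> P y) \<Longrightarrow> eventually P (nhds x)" for x :: real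
  by (rule eventually_mono[OF eventually_nhds_in_open[of "{0<..}"]]) auto

text \<open>\<open>deriv\<close> depends only on the germ of a function and \<open>(0,\<infinity>)\<close> is open, so agreement of \<open>f\<close> with
  \<open>g 0\<close> on the half-line propagates to all derivatives.\<close>

lemma derivative_chain_higher_deriv:
  assumes g: "derivative_chain g" and f: "\<And>x. x > 0 \<Longrightarrow> f x = g 0 x" and "x > 0"
  shows "(deriv ^^ n) f x = g n x"
  using \<open>x > 0\<close>
proof (induction n arbitrary: x)
  case (Suc n)
  have "((deriv ^^ n) f has_real_derivative g (Suc n) x) (at x)"
  proof (subst DERIV_cong_ev)
    show "(g n has_real_derivative g (Suc n) x) (at x)"
      using g Suc.prems by (simp add: derivative_chain_def)
    show "\<forall>\<^sub>F y in nhds x. (deriv ^^ n) f y = g n y"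
      using Suc by (intro eventually_pos_nhds) auto
  qed auto
  then show ?case by (simp add: DERIV_imp_deriv)
qed (simp add: f)

lemma derivative_chain_smooth:
  assumes g: "derivative_chain g" and f: "\<And>x. x > 0 \<Longrightarrow> f x = g 0 x"
  shows "smooth_pos f"
  unfolding smooth_pos_def
proof safe
  fix n and x :: real assume x: "x > 0"
  have "((deriv ^^ n) f has_real_derivative g (Suc n) x) (at x)"
  proof (subst DERIV_cong_ev)
    show "(g n has_real_derivative g (Suc n) x) (at x)"
      using g x by (simp add: derivative_chain_def)
    show "\<forall>\<^sub>F y in nhds x. (deriv ^^ n) f y = g n y"
      using derivative_chain_higher_deriv[OF g f] x by (intro eventually_pos_nhds) auto
  qed auto
  then show "(deriv ^^ n) f differentiable at x"
    using real_differentiable_def by blast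
qed

lemma smooth_pos_derivative_chain:
  assumes "smooth_pos f" shows "derivative_chain (\<lambda>n. (deriv ^^ n) f)"
  using assms unfolding smooth_pos_def derivative_chain_def
  by (auto simp: DERIV_deriv_iff_real_differentiable)

lemma bernstein_function_derivative_chainI:
  assumes g: "derivative_chain g" and F: "\<And>x. x > 0 \<Longrightarrow> F x = g 0 x"
    and nonneg: "\<And>x. x > 0 \<Longrightarrow> F x \<ge> 0"
    and sign: "\<And>n x. x > 0 \<Longrightarrow> (-1) ^ n * g (Suc n) x \<ge> 0"
  shows "bernstein_function F"
proof -
  have g': "derivative_chain (\<lambda>n. g (Suc n))"
    using g by (auto simp: derivative_chain_def)
  have F': "deriv F x = g (Suc 0) x" if "x > 0" for x
    using derivative_chain_higher_deriv[OF g F that, of 1] by simp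
  show ?thesis
    unfolding bernstein_function_def completely_monotone_def
    using nonneg sign derivative_chain_smooth[OF g F] derivative_chain_smooth[OF g' F']
      derivative_chain_higher_deriv[OF g' F'] by simp
qed

text \<open>If \<open>v' = - c (v + E v\<^sup>2)\<close>, then \<open>(Q(v))' = - (c Q' \<cdot> (X + E X\<^sup>2))(v)\<close>. The polynomials below iterate
  this operation on \<open>Q\<close>, so the \<open>n\<close>-th derivative of \<open>P(v)\<close> is \<open>(-1)\<^sup>n\<close> times the \<open>n\<close>-th of them at \<open>v\<close>.\<close>

primrec logistic_poly :: "real \<Rightarrow> real \<Rightarrow> real poly \<Rightarrow> nat \<Rightarrow> real poly" where
  "logistic_poly c E P 0 = P"
| "logistic_poly c E P (Suc n) = smult c (pderiv (logistic_poly c E P n) * [:0, 1, E:])"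

lemma poly_nonneg_if_coeffs_nonneg:
  fixes P :: "real poly"
  assumes "\<And>i. coeff P i \<ge> 0" and "y \<ge> 0"
  shows "poly P y \<ge> 0"
  unfolding poly_altdef using assms by (intro sum_nonneg) auto

lemma logistic_poly_coeffs_nonneg:
  assumes "c \<ge> 0" "E \<ge> 0" "\<And>i. coeff P i \<ge> 0"
  shows "coeff (logistic_poly c E P n) i \<ge> 0"
proof (induction n arbitrary: i)
  case 0
  then show ?case by (simp add: assms)
next
  case (Suc n)
  have "coeff [:0, 1, E:] j \<ge> 0" for j
    using \<open>E \<ge> 0\<close> by (simp add: coeff_pCons split: nat.splits)
  with Suc show ?case using \<open>c \<ge> 0\<close>
    by (simp only: logistic_poly.simps coeff_smult coeff_mult coeff_pderiv) (intro mult_nonneg_nonneg sum_nonneg, auto)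
qed

lemma logistic_derivative_chain:
  assumes v: "\<And>x. x > 0 \<Longrightarrow> (v has_real_derivative - c * (v x + E * (v x)\<^sup>2)) (at x)"
  shows "derivative_chain (\<lambda>n x. (-1) ^ n * poly (logistic_poly c E P n) (v x))"
  unfolding derivative_chain_def
proof safe
  fix n and x :: real assume "x > 0"
  show "((\<lambda>x. (-1) ^ n * poly (logistic_poly c E P n) (v x)) has_real_derivative
         (-1) ^ Suc n * poly (logistic_poly c E P (Suc n)) (v x)) (at x)"
    unfolding logistic_poly.simps
    by (rule derivative_eq_intros DERIV_chain2[where f="poly _"] poly_DERIV v[OF \<open>x > 0\<close>] refl)+
      (simp add: algebra_simps power2_eq_square)
qed

section \<open>The Moebius transform of an exponential\<close>

lemma mobius_exp_derivative:
  fixes c D N :: real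
  assumes "1 + D * exp (- c * x) \<noteq> 0"
  shows "((\<lambda>x. exp (- c * x) / (1 + D * exp (- c * x))) has_real_derivative
      - c * (exp (- c * x) / (1 + D * exp (- c * x))\<^sup>2)) (at x)"
  using assms
  by (auto intro!: derivative_eq_intros simp: field_simps power2_eq_square)

text \<open>\<open>F = 1 - (D - N) v\<close> for \<open>v = u / (1 + D u)\<close>, which solves the logistic equation with \<open>E = - D\<close>. The
  linear coefficient of this polynomial is negative, but one differentiation turns it into minus a
  polynomial with nonnegative coefficients, and from there on the signs alternate.\<close>

lemma bernstein_function_mobius_exp:
  fixes c D N :: real
  assumes c: "c > 0" and D: "-1 < D" "D \<le> 0" and N: "-1 < N" "N \<le> D"
    and F: "\<And>x. x > 0 \<Longrightarrow> F x = (1 + N * exp (- c * x)) / (1 + D * exp (- c * x))"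
  shows "bernstein_function F"
    and "\<And>x. x > 0 \<Longrightarrow> (F has_real_derivative
          c * (D - N) * (exp (- c * x) / (1 + D * exp (- c * x))\<^sup>2)) (at x)"
proof -
  define v where "v x = exp (- c * x) / (1 + D * exp (- c * x))" for x
  have pos: "1 + M * exp (- c * x) > 0" if "x > 0" "-1 < M" for x M
  proof -
    have u: "0 < exp (- c * x)" "exp (- c * x) < 1" using c that by auto
    then have "- M * exp (- c * x) < 1"
      using that mult_strict_mono[of "-M" 1 "exp (-c*x)" 1]
      by (cases "M \<ge> 0") (auto simp: mult_le_0_iff intro: le_less_trans[of _ 0])
    then show ?thesis by simp
  qed
  have v': "(v has_real_derivative - c * (v x + (- D) * (v x)\<^sup>2)) (at x)" if "x > 0" for x
  proof -
    \<comment> \<open>With \<open>u\<close> and \<open>w = 1 + D u\<close> abstract, this is a rational identity.\<close>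
    have "u / w + (- D) * (u / w)\<^sup>2 = u / w\<^sup>2" if "w = 1 + D * u" "w > 0" for u w :: real
    proof -
      have "u / w + (- D) * (u / w)\<^sup>2 = (u * w - D * u\<^sup>2) / w\<^sup>2"
        using that(2) by (simp add: field_simps power2_eq_square)
      also have "u * w - D * u\<^sup>2 = u" by (simp add: that(1) algebra_simps power2_eq_square)
      finally show ?thesis .
    qed
    from this[OF refl pos[OF that D(1)]]
    have "- c * (v x + (- D) * (v x)\<^sup>2) = - c * (exp (- c * x) / (1 + D * exp (- c * x))\<^sup>2)"
      unfolding v_def by simp
    then show ?thesis
      using mobius_exp_derivative[of D c x] pos[OF that D(1)] unfolding v_def by simp
  qed
  define P where "P = [:1, - (D - N):]"
  have Fv: "F x = poly P (v x)" if "x > 0" for x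
    using pos[OF that D(1)] F[OF that] by (simp add: P_def v_def field_simps)
  let ?g = "\<lambda>n x. (-1) ^ n * poly (logistic_poly c (-D) P n) (v x)"
  have chain: "derivative_chain ?g" by (rule logistic_derivative_chain) (rule v')
  \<comment> \<open>From the first derivative on, the start polynomial may be replaced by one with nonnegative coefficients.\<close>
  have P1: "logistic_poly c (-D) P (Suc n) = - logistic_poly c (-D) [:0, c * (D - N), c * (D - N) * (-D):] n" for n
  proof (induction n)
    case 0
    show ?case by (simp add: P_def pderiv_pCons algebra_simps)
  next
    case (Suc n)
    then show ?case
      by (simp only: logistic_poly.simps pderiv_minus mult_minus_left smult_minus_right)
  qed
  show "bernstein_function F"
  proof (rule bernstein_function_derivative_chainI[OF chain])
    fix x :: real assume x: "x > 0"
    show "F x = ?g 0 x" using Fv[OF x] by simp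
    show "F x \<ge> 0" using F[OF x] pos[OF x D(1)] pos[OF x N(1)] by simp
    fix n
    have "coeff [:0, c * (D - N), c * (D - N) * (-D):] j \<ge> 0" for j
      using c D N by (auto simp: coeff_pCons mult_le_0_iff split: nat.splits)
    then have "poly (logistic_poly c (-D) [:0, c * (D - N), c * (D - N) * (-D):] n) (v x) \<ge> 0"
      using c D pos[OF x D(1)]
      by (intro poly_nonneg_if_coeffs_nonneg logistic_poly_coeffs_nonneg) (auto simp: v_def)
    then show "(-1) ^ n * ?g (Suc n) x \<ge> 0"
      unfolding P1 by (simp flip: power_add mult.assoc)
  qed
  fix x :: real assume x: "x > 0"
  have "(v has_real_derivative - c * (exp (- c * x) / (1 + D * exp (- c * x))\<^sup>2)) (at x)"
    using mobius_exp_derivative[of D c x] pos[OF x D(1)] unfolding v_def by simp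
  from DERIV_diff[OF DERIV_const[of 1] DERIV_cmult[OF this, of "D - N"]]
  have "((\<lambda>x. 1 - (D - N) * v x) has_real_derivative
          c * (D - N) * (exp (- c * x) / (1 + D * exp (- c * x))\<^sup>2)) (at x)"
    by (simp add: mult_ac)
  then show "(F has_real_derivative
          c * (D - N) * (exp (- c * x) / (1 + D * exp (- c * x))\<^sup>2)) (at x)"
    using Fv x by (subst DERIV_cong_ev[where g="\<lambda>x. 1 - (D - N) * v x"])
      (auto intro!: eventually_pos_nhds simp: P_def algebra_simps)
qed

lemma mobius_exp_derivative_series:
  fixes c D :: real
  assumes "c > 0" "\<bar>D\<bar> < 1" "x > 0"
  shows "(\<lambda>m. real (Suc m) * (- D) ^ m * exp (- real (Suc m) * c * x)) sums
           (exp (- c * x) / (1 + D * exp (- c * x))\<^sup>2)"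
proof -
  define u where "u = exp (- c * x)"
  have u: "0 < u" "u < 1" using assms by (auto simp: u_def)
  have "\<bar>D\<bar> * u < 1 * 1" using assms(2) u by (intro mult_strict_mono) auto
  then have "norm (- D * u) < 1" using u by (simp add: abs_mult)
  from sums_mult[OF geometric_deriv_sums[OF this], of u]
  have sums: "(\<lambda>m. u * (real (Suc m) * (- D * u) ^ m)) sums (u / (1 + D * u)\<^sup>2)" by simp
  have eq: "u * (real (Suc m) * (- D * u) ^ m)
      = real (Suc m) * (- D) ^ m * exp (- real (Suc m) * c * x)" for m
  proof -
    have "exp (- real (Suc m) * c * x) = u ^ Suc m"
      unfolding u_def by (subst exp_of_nat_mult[symmetric]) (simp add: algebra_simps)
    then show ?thesis by (simp only: power_mult_distrib power_Suc ac_simps)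
  qed
  show ?thesis using sums unfolding eq unfolding u_def .
qed

section \<open>Differences of Bernstein functions\<close>

definition backward_diff :: "(nat \<Rightarrow> real) \<Rightarrow> nat \<Rightarrow> real" where
  "backward_diff e n = e n - e (Suc n)"

text \<open>The mean value theorem expresses the unit difference of the \<open>n\<close>-th derivative by a value of the
  next derivative, whose sign is known.\<close>

lemma completely_monotone_unit_step:
  assumes g: "derivative_chain g" and x: "x > 0"
    and sign: "\<And>n x. x > 0 \<Longrightarrow> (-1) ^ n * g (Suc n) x \<le> 0"
  shows "(-1) ^ n * (g n x - g n (x + 1)) \<ge> 0"
proof -
  have "\<exists>z>x. z < x + 1 \<and> g n (x + 1) - g n x = (x + 1 - x) * g (Suc n) z"
    using g x by (intro MVT2) (auto simp: derivative_chain_def)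
  then obtain z where "z > x" "g n (x + 1) - g n x = g (Suc n) z" by auto
  then show ?thesis using sign[of z n] x by (simp add: algebra_simps)
qed

text \<open>Complete monotonicity passes from \<open>f\<close> to \<open>x \<mapsto> f(x) - f(x+1)\<close>, so it survives any number of
  backward differences; evaluating at the positive integers gives a totally monotone sequence. The
  argument starts at 1 because nothing is assumed at 0.\<close>

lemma completely_monotone_iterated_diff:
  assumes "derivative_chain g" and "\<And>n x. x > 0 \<Longrightarrow> (-1) ^ n * g n x \<ge> 0"
  shows "(backward_diff ^^ k) (\<lambda>n. g 0 (real (Suc n))) n \<ge> 0"
  using assms
proof (induction k arbitrary: g)
  case 0
  from 0(2)[of "real (Suc n)" 0] show ?case by simp
next
  case (Suc k)
  let ?h = "\<lambda>n x. g n x - g n (x + 1)"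
  have "(backward_diff ^^ k) (\<lambda>n. ?h 0 (real (Suc n))) n \<ge> 0"
  proof (rule Suc.IH)
    show "derivative_chain ?h"
      using Suc.prems(1) unfolding derivative_chain_def
      by (auto intro!: DERIV_diff simp: DERIV_shift[symmetric])
    show "(-1) ^ n * ?h n x \<ge> 0" if "x > 0" for n x
      using Suc.prems that by (intro completely_monotone_unit_step) (auto simp: mult.assoc[symmetric] dest: Suc.prems(2)[of _ "Suc _"])
  qed
  moreover have "(\<lambda>n. ?h 0 (real (Suc n))) = backward_diff (\<lambda>n. g 0 (real (Suc n)))"
    by (auto simp: backward_diff_def add.commute)
  ultimately show ?case by (simp only: funpow_Suc_right o_apply)
qed

text \<open>The unit increment of a Bernstein function is completely monotone, again by the mean value
  theorem.\<close>

lemma bernstein_function_increments_totally_monotone: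
  assumes "bernstein_function G"
  shows "(backward_diff ^^ k) (\<lambda>n. G (real (Suc (Suc n))) - G (real (Suc n))) n \<ge> 0"
proof -
  let ?g = "\<lambda>n. (deriv ^^ n) G"
  have chain: "derivative_chain ?g"
    using assms by (intro smooth_pos_derivative_chain) (simp add: bernstein_function_def)
  have sign: "(-1) ^ n * ?g (Suc n) x \<ge> 0" if "x > 0" for n x
    using assms that unfolding bernstein_function_def completely_monotone_def
    by (simp add: funpow_Suc_right del: funpow.simps)
  let ?h = "\<lambda>n x. ?g n (x + 1) - ?g n x"
  have neg: "derivative_chain (\<lambda>n x. - ?g n x)"
    using chain by (auto simp: derivative_chain_def intro!: DERIV_minus)
  have "(backward_diff ^^ k) (\<lambda>n. ?h 0 (real (Suc n))) n \<ge> 0"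
  proof (rule completely_monotone_iterated_diff)
    show "derivative_chain ?h"
      using chain unfolding derivative_chain_def
      by (auto intro!: DERIV_diff simp: DERIV_shift[symmetric])
    show "(-1) ^ n * ?h n x \<ge> 0" if "x > 0" for n x
      using completely_monotone_unit_step[OF neg that, of n] sign by auto
  qed
  then show ?thesis by (simp add: add.commute)
qed

section \<open>Positive functionals on continuous functions and their moments\<close>

text \<open>Functionals are total on all functions, but linearity and the bound by the supremum norm are
  only required on \<open>C[0,1]\<close>, where integrals and absolutely convergent sums have them.\<close>

definition bounded_functional :: "real \<Rightarrow> ((real \<Rightarrow> real) \<Rightarrow> real) \<Rightarrow> bool" where
  "bounded_functional C L \<longleftrightarrow>
     (\<forall>f g. continuous_on {0..1} f \<longrightarrow> continuous_on {0..1} g \<longrightarrow> L (\<lambda>x. f x + g x) = L f + L g)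
   \<and> (\<forall>f c. continuous_on {0..1} f \<longrightarrow> L (\<lambda>x. c * f x) = c * L f)
   \<and> (\<forall>f B. continuous_on {0..1} f \<longrightarrow> (\<forall>x\<in>{0..1}. \<bar>f x\<bar> \<le> B) \<longrightarrow> \<bar>L f\<bar> \<le> C * B)"

lemma bounded_functional_diff:
  assumes "bounded_functional C L" "continuous_on {0..1} f" "continuous_on {0..1} g"
  shows "L (\<lambda>x. f x - g x) = L f - L g"
proof -
  have "continuous_on {0..1} (\<lambda>x. (-1) * g x)" by (intro continuous_intros assms)
  then have "L (\<lambda>x. f x + (-1) * g x) = L f + L (\<lambda>x. (-1) * g x)"
    using assms unfolding bounded_functional_def by blast
  also have "L (\<lambda>x. (-1) * g x) = (-1) * L g"
    using assms unfolding bounded_functional_def by blast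
  finally show ?thesis by simp
qed

lemma bounded_functional_sum:
  assumes L: "bounded_functional C L" and "\<And>k. continuous_on {0..1} (g k)" and "finite I"
  shows "L (\<lambda>x. \<Sum>k\<in>I. c k * g k x) = (\<Sum>k\<in>I. c k * L (g k))"
  using \<open>finite I\<close>
proof (induction I rule: finite_induct)
  case empty
  have "L (\<lambda>x. 0 * g undefined x) = 0 * L (g undefined)"
    using assms unfolding bounded_functional_def by blast
  then show ?case by simp
next
  case (insert k I)
  have "continuous_on {0..1} (\<lambda>x. c k * g k x)" "continuous_on {0..1} (\<lambda>x. \<Sum>k\<in>I. c k * g k x)"
    using assms(2) by (auto intro!: continuous_intros)
  then have "L (\<lambda>x. c k * g k x + (\<Sum>k\<in>I. c k * g k x)) = L (\<lambda>x. c k * g k x) + L (\<lambda>x. \<Sum>k\<in>I. c k * g k x)"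
    using L unfolding bounded_functional_def by blast
  moreover have "L (\<lambda>x. c k * g k x) = c k * L (g k)"
    using L assms(2) unfolding bounded_functional_def by blast
  ultimately show ?case using insert by simp
qed

lemma backward_diff_moments:
  assumes "bounded_functional C L"
  shows "(backward_diff ^^ k) (\<lambda>n. L (\<lambda>x. x ^ n)) n = L (\<lambda>x. x ^ n * (1 - x) ^ k)"
proof (induction k arbitrary: n)
  case (Suc k)
  have "(\<lambda>x::real. x ^ n * (1 - x) ^ Suc k) = (\<lambda>x. x ^ n * (1 - x) ^ k - x ^ Suc n * (1 - x) ^ k)"
    by (auto simp: algebra_simps)
  moreover have "L (\<lambda>x. x ^ n * (1 - x) ^ k - x ^ Suc n * (1 - x) ^ k)
      = L (\<lambda>x. x ^ n * (1 - x) ^ k) - L (\<lambda>x. x ^ Suc n * (1 - x) ^ k)"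
    by (intro bounded_functional_diff[OF assms] continuous_intros)
  ultimately show ?case using Suc by (simp add: backward_diff_def)
qed simp

text \<open>The positivity half of Hausdorff's moment theorem. The hypothesis makes \<open>L\<close> nonnegative on
  every Bernstein basis polynomial, hence on the Bernstein polynomials of \<open>f \<ge> 0\<close>, which converge to
  \<open>f\<close> uniformly; boundedness of \<open>L\<close> transports the sign to the limit.\<close>

lemma totally_monotone_functional_nonneg:
  assumes L: "bounded_functional C L"
    and mono: "\<And>k n. (backward_diff ^^ k) (\<lambda>n. L (\<lambda>x. x ^ n)) n \<ge> 0"
    and f: "continuous_on {0..1} f" "\<And>x. x \<in> {0..1} \<Longrightarrow> f x \<ge> 0"
  shows "L f \<ge> 0"
proof -
  have bound: "\<bar>L g\<bar> \<le> C * B" if "continuous_on {0..1} g" "\<And>x. x \<in> {0..1} \<Longrightarrow> \<bar>g x\<bar> \<le> B" for g B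
    using L that unfolding bounded_functional_def by blast
  have "C \<ge> 0" using bound[of "\<lambda>x. 0" 1] by simp
  have "- L f \<le> 0 + e" if "e > 0" for e
  proof -
    \<comment> \<open>\<open>C + 1\<close> in place of \<open>C\<close> covers \<open>C = 0\<close>.\<close>
    have "e / (C + 1) > 0" using that \<open>C \<ge> 0\<close> by simp
    from Bernstein_Weierstrass[OF f(1) this] obtain n where
      n: "\<And>x. x \<in> {0..1} \<Longrightarrow> \<bar>f x - (\<Sum>k\<le>n. f (k/n) * Bernstein n k x)\<bar> < e / (C + 1)"
      by blast
    have cont: "continuous_on {0..1} (Bernstein n k)" for k
      unfolding Bernstein_def by (intro continuous_intros)
    have "L (Bernstein n k) \<ge> 0" for k
    proof -
      have "continuous_on {0..1} (\<lambda>x::real. x ^ k * (1 - x) ^ (n - k))"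
        by (intro continuous_intros)
      then have "L (\<lambda>x. real (n choose k) * (x ^ k * (1 - x) ^ (n - k)))
          = real (n choose k) * L (\<lambda>x. x ^ k * (1 - x) ^ (n - k))"
        using L unfolding bounded_functional_def by blast
      then show ?thesis
        using mono[of "n - k" k] unfolding backward_diff_moments[OF L] Bernstein_def
        by (simp add: mult.assoc)
    qed
    then have "0 \<le> (\<Sum>k\<le>n. f (k/n) * L (Bernstein n k))"
      by (intro sum_nonneg mult_nonneg_nonneg f(2)) (auto simp: divide_le_eq_1)
    also have "\<dots> = L (\<lambda>x. \<Sum>k\<le>n. f (k/n) * Bernstein n k x)"
      by (rule bounded_functional_sum[symmetric, OF L cont]) simp
    also have "\<dots> = L f - L (\<lambda>x. f x - (\<Sum>k\<le>n. f (k/n) * Bernstein n k x))"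
      by (subst bounded_functional_diff[OF L f(1)]) (auto intro!: continuous_intros continuous_on_sum cont)
    also have "\<dots> \<le> L f + C * (e / (C + 1))"
    proof -
      have "\<bar>L (\<lambda>x. f x - (\<Sum>k\<le>n. f (k/n) * Bernstein n k x))\<bar> \<le> C * (e / (C + 1))"
        using n by (intro bound) (auto intro!: continuous_intros f cont less_imp_le)
      then show ?thesis by linarith
    qed
    also have "C * (e / (C + 1)) \<le> e" using \<open>C \<ge> 0\<close> \<open>e > 0\<close> by (simp add: field_simps)
    finally show ?thesis by simp
  qed
  then have "- L f \<le> 0" by (rule field_le_epsilon)
  then show ?thesis by simp
qed

lemma summable_weighted:
  fixes w :: "nat \<Rightarrow> real"
  assumes "summable (\<lambda>m. \<bar>w m\<bar>)" "\<And>m. \<bar>g m\<bar> \<le> B"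
  shows "summable (\<lambda>m. w m * g m)" and "\<bar>\<Sum>m. w m * g m\<bar> \<le> (\<Sum>m. \<bar>w m\<bar>) * B"
proof -
  have le: "\<bar>w m * g m\<bar> \<le> \<bar>w m\<bar> * B" for m
    by (simp add: abs_mult assms mult_left_mono)
  have sm: "summable (\<lambda>m. \<bar>w m\<bar> * B)" by (intro summable_mult2 assms)
  have abs: "summable (\<lambda>m. \<bar>w m * g m\<bar>)"
    by (rule summable_comparison_test'[OF sm, of 0]) (use le in auto)
  then show "summable (\<lambda>m. w m * g m)" by (rule summable_rabs_cancel)
  have "\<bar>\<Sum>m. w m * g m\<bar> \<le> (\<Sum>m. \<bar>w m * g m\<bar>)" by (rule summable_rabs[OF abs])
  also have "\<dots> \<le> (\<Sum>m. \<bar>w m\<bar> * B)" by (rule suminf_le[OF le abs sm])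
  also have "\<dots> = (\<Sum>m. \<bar>w m\<bar>) * B" by (rule suminf_mult2[symmetric, OF assms(1)])
  finally show "\<bar>\<Sum>m. w m * g m\<bar> \<le> (\<Sum>m. \<bar>w m\<bar>) * B" .
qed

lemma bounded_functional_discrete:
  fixes w x :: "nat \<Rightarrow> real"
  assumes w: "summable (\<lambda>m. \<bar>w m\<bar>)" and x: "\<And>m. x m \<in> {0..1}"
  shows "bounded_functional (\<Sum>m. \<bar>w m\<bar>) (\<lambda>f. \<Sum>m. w m * f (x m))"
proof -
  have sm: "summable (\<lambda>m. w m * f (x m))" if "continuous_on {0..1} f" for f :: "real \<Rightarrow> real"
  proof -
    have "bounded (f ` {0..1})" using that by (intro compact_imp_bounded compact_continuous_image) auto
    then obtain B where "\<forall>z\<in>f ` {0..1}. norm z \<le> B" unfolding bounded_iff by blast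
    then have "\<And>y. y \<in> {0..1} \<Longrightarrow> \<bar>f y\<bar> \<le> B" by simp
    then show ?thesis using x by (intro summable_weighted(1)[OF w]) auto
  qed
  show ?thesis
    unfolding bounded_functional_def
  proof (intro conjI allI impI)
    fix f g :: "real \<Rightarrow> real" assume f: "continuous_on {0..1} f" and g: "continuous_on {0..1} g"
    show "(\<Sum>m. w m * (f (x m) + g (x m))) = (\<Sum>m. w m * f (x m)) + (\<Sum>m. w m * g (x m))"
      by (simp add: suminf_add[OF sm[OF f] sm[OF g]] distrib_left)
  next
    fix f :: "real \<Rightarrow> real" and c assume f: "continuous_on {0..1} f"
    show "(\<Sum>m. w m * (c * f (x m))) = c * (\<Sum>m. w m * f (x m))"
      by (simp add: suminf_mult[OF sm[OF f], symmetric] mult.left_commute)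
  next
    fix f :: "real \<Rightarrow> real" and B assume "\<forall>x\<in>{0..1}. \<bar>f x\<bar> \<le> B"
    then show "\<bar>\<Sum>m. w m * f (x m)\<bar> \<le> (\<Sum>m. \<bar>w m\<bar>) * B"
      using x by (intro summable_weighted(2)[OF w]) auto
  qed
qed

text \<open>The tent of height 1 and radius \<open>r\<close> at the node \<open>x j\<close> vanishes at all other nodes, so the
  discrete functional evaluates it to \<open>w j\<close>.\<close>

lemma totally_monotone_isolated_weight_nonneg:
  fixes w x :: "nat \<Rightarrow> real"
  assumes w: "summable (\<lambda>m. \<bar>w m\<bar>)" and x: "\<And>m. x m \<in> {0..1}"
    and isolated: "r > 0" "\<And>m. m \<noteq> j \<Longrightarrow> r \<le> \<bar>x m - x j\<bar>"
    and mono: "\<And>k n. (backward_diff ^^ k) (\<lambda>n. \<Sum>m. w m * x m ^ n) n \<ge> 0"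
  shows "w j \<ge> 0"
proof -
  define f where "f y = max 0 (1 - \<bar>y - x j\<bar> / r)" for y
  have "0 \<le> (\<Sum>m. w m * f (x m))"
    by (rule totally_monotone_functional_nonneg[OF bounded_functional_discrete[OF w x] mono])
      (use isolated in \<open>auto simp: f_def intro!: continuous_intros\<close>)
  also have "(\<lambda>m. w m * f (x m)) = (\<lambda>m. if m = j then w j else 0)"
  proof
    show "w m * f (x m) = (if m = j then w j else 0)" for m
      using isolated(1) isolated(2)[of m] by (cases "m = j") (auto simp: f_def max_def)
  qed
  also have "(\<Sum>m. if m = j then w j else 0) = w j"
    using sums_single[of j "\<lambda>_. w j"] by (simp add: sums_iff)
  finally show ?thesis .
qed

section \<open>The Jordan decomposition\<close>

lemma signed_measure_uminus: "signed_measure M \<tau> \<Longrightarrow> signed_measure M (\<lambda>A. - \<tau> A)"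
  unfolding signed_measure_def by (auto intro: sums_minus)

lemma signed_measure_Un:
  assumes \<tau>: "signed_measure M \<tau>" and "A \<in> sets M" "B \<in> sets M" "A \<inter> B = {}"
  shows "\<tau> (A \<union> B) = \<tau> A + \<tau> B"
proof -
  have "disjoint_family (binaryset A B)"
    using assms by (auto simp: disjoint_family_on_def binaryset_def)
  moreover have "range (binaryset A B) \<subseteq> sets M"
    using assms by (simp add: range_binaryset_eq)
  ultimately have "(\<lambda>i. \<tau> (binaryset A B i)) sums \<tau> (A \<union> B)"
    using \<tau> unfolding signed_measure_def by (metis UN_binaryset_eq)
  moreover have "(\<lambda>i. \<tau> (binaryset A B i)) sums (\<tau> A + \<tau> B)"
    using \<tau> by (intro binaryset_sums) (simp add: signed_measure_def)
  ultimately show ?thesis by (rule sums_unique2)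
qed

lemma signed_measure_Diff:
  assumes \<tau>: "signed_measure M \<tau>" and "A \<in> sets M" "B \<in> sets M" "B \<subseteq> A"
  shows "\<tau> (A - B) = \<tau> A - \<tau> B"
  using signed_measure_Un[OF \<tau>, of B "A - B"] assms by (simp add: Un_absorb1)

text \<open>If the values were unbounded, a set on which they are unbounded could be split so that one
  part again has this property while the other has a value of modulus at least 1. Iterating yields
  disjoint sets whose values do not tend to 0, contrary to countable additivity.\<close>

lemma signed_measure_bounded:
  assumes \<tau>: "signed_measure M \<tau>"
  obtains K where "\<And>A. A \<in> sets M \<Longrightarrow> \<tau> A \<le> K"
proof (rule ccontr)
  assume no: "\<not> thesis"
  define unb where "unb A \<longleftrightarrow> A \<in> sets M \<and> (\<forall>K. \<exists>B\<in>sets M. B \<subseteq> A \<and> K < \<bar>\<tau> B\<bar>)" for A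
  have "unb (space M)"
  proof -
    have "\<exists>B\<in>sets M. B \<subseteq> space M \<and> K < \<bar>\<tau> B\<bar>" for K
    proof (rule ccontr)
      assume "\<not> ?thesis"
      then have "\<And>A. A \<in> sets M \<Longrightarrow> \<bar>\<tau> A\<bar> \<le> K"
        using sets.sets_into_space by (metis not_less)
      then have "\<And>A. A \<in> sets M \<Longrightarrow> \<tau> A \<le> K" by (metis abs_le_iff)
      then show False using no that by blast
    qed
    then show ?thesis by (simp add: unb_def)
  qed
  have step: "\<exists>B. unb B \<and> B \<subseteq> A \<and> 1 \<le> \<bar>\<tau> (A - B)\<bar>" if A: "unb A" for A
  proof -
    obtain E where E: "E \<in> sets M" "E \<subseteq> A" "\<bar>\<tau> A\<bar> + 1 < \<bar>\<tau> E\<bar>"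
      using A unfolding unb_def by blast
    have AE: "A - E \<in> sets M" "A \<in> sets M" using A E by (auto simp: unb_def)
    have diff: "\<tau> (A - E) = \<tau> A - \<tau> E" using signed_measure_Diff[OF \<tau>] AE E by blast
    have "unb E \<or> unb (A - E)"
    proof (rule ccontr)
      assume "\<not> ?thesis"
      then obtain K1 K2 where K: "\<And>B. B \<in> sets M \<Longrightarrow> B \<subseteq> E \<Longrightarrow> \<bar>\<tau> B\<bar> \<le> K1"
        "\<And>B. B \<in> sets M \<Longrightarrow> B \<subseteq> A - E \<Longrightarrow> \<bar>\<tau> B\<bar> \<le> K2"
        using E AE unfolding unb_def by (metis not_less)
      obtain B where B: "B \<in> sets M" "B \<subseteq> A" "K1 + K2 < \<bar>\<tau> B\<bar>"
        using A unfolding unb_def by blast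
      have "\<tau> ((B \<inter> E) \<union> (B \<inter> (A - E))) = \<tau> (B \<inter> E) + \<tau> (B \<inter> (A - E))"
        using B E AE by (intro signed_measure_Un[OF \<tau>]) auto
      moreover have "(B \<inter> E) \<union> (B \<inter> (A - E)) = B" using B by auto
      ultimately have "\<tau> B = \<tau> (B \<inter> E) + \<tau> (B \<inter> (A - E))" by simp
      moreover have "\<bar>\<tau> (B \<inter> E)\<bar> \<le> K1" "\<bar>\<tau> (B \<inter> (A - E))\<bar> \<le> K2"
        using K B E AE by (auto intro: sets.Int)
      ultimately show False using B(3) by linarith
    qed
    then show ?thesis
    proof
      assume "unb E"
      then show ?thesis using E diff by (intro exI[of _ E]) auto
    next
      assume "unb (A - E)"
      moreover have "A - (A - E) = E" using E by auto
      ultimately show ?thesis using E by (intro exI[of _ "A - E"]) auto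
    qed
  qed
  obtain S where S: "\<And>n. unb (S n)" "\<And>n. S (Suc n) \<subseteq> S n" "\<And>n. 1 \<le> \<bar>\<tau> (S n - S (Suc n))\<bar>"
    using dependent_nat_choice[of "\<lambda>_. unb" "\<lambda>_ A B. B \<subseteq> A \<and> 1 \<le> \<bar>\<tau> (A - B)\<bar>"]
      \<open>unb (space M)\<close> step by (metis (no_types, lifting))
  have anti: "S n \<subseteq> S m" if "m \<le> n" for m n
    using that by (rule lift_Suc_antimono_le[of S, OF S(2)])
  have "disjoint_family (\<lambda>n. S n - S (Suc n))"
  proof (unfold disjoint_family_on_def, intro ballI impI)
    fix m n :: nat assume "m \<noteq> n"
    then consider "Suc m \<le> n" | "Suc n \<le> m" by linarith
    then show "(S m - S (Suc m)) \<inter> (S n - S (Suc n)) = {}"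
      by cases (use anti in blast)+
  qed
  moreover have "range (\<lambda>n. S n - S (Suc n)) \<subseteq> sets M" using S(1) by (auto simp: unb_def)
  ultimately have "(\<lambda>n. \<tau> (S n - S (Suc n))) sums \<tau> (\<Union>n. S n - S (Suc n))"
    using \<tau> unfolding signed_measure_def by blast
  then have "(\<lambda>n. \<tau> (S n - S (Suc n))) \<longlonglongrightarrow> 0"
    using sums_summable summable_LIMSEQ_zero by blast
  then have "\<forall>\<^sub>F n in sequentially. \<bar>\<tau> (S n - S (Suc n))\<bar> < 1"
    by (auto dest!: tendstoD[where e=1] simp: dist_real_def)
  then show False using S(3) by (auto simp: eventually_sequentially not_less[symmetric])
qed

lemma sets_positive_variation [simp]: "sets (positive_variation M \<tau>) = sets M"
  and space_positive_variation [simp]: "space (positive_variation M \<tau>) = space M"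
  by (simp_all add: positive_variation_def)

lemma sets_negative_variation [simp]: "sets (negative_variation M \<tau>) = sets M"
  and space_negative_variation [simp]: "space (negative_variation M \<tau>) = space M"
  by (simp_all add: negative_variation_def)

text \<open>The supremum is superadditive since subsets of disjoint sets can be combined, and countably
  subadditive since a subset of a union is cut into pieces by its members.\<close>

lemma countably_additive_positive_variation:
  assumes \<tau>: "signed_measure M \<tau>"
  shows "countably_additive (sets M) (\<lambda>A. SUP B\<in>{B \<in> sets M. B \<subseteq> A}. ennreal (\<tau> B))"
    (is "countably_additive _ ?P")
proof (rule countably_additiveI)
  have upper: "ennreal (\<tau> B) \<le> ?P A" if "B \<in> sets M" "B \<subseteq> A" for A B
    by (rule SUP_upper) (use that in simp)
  have mono: "?P A \<le> ?P B" if "A \<subseteq> B" for A B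
    by (rule SUP_subset_mono) (use that in auto)
  have super: "?P A + ?P B \<le> ?P (A \<union> B)" if AB: "A \<in> sets M" "B \<in> sets M" "A \<inter> B = {}" for A B
  proof -
    have "ennreal (\<tau> A') + ennreal (\<tau> B') \<le> ?P (A \<union> B)"
      if A': "A' \<in> sets M" "A' \<subseteq> A" and B': "B' \<in> sets M" "B' \<subseteq> B" for A' B'
    proof (cases "\<tau> A' \<le> 0 \<or> \<tau> B' \<le> 0")
      case True
      moreover have "ennreal (\<tau> A') \<le> ?P (A \<union> B)" "ennreal (\<tau> B') \<le> ?P (A \<union> B)"
        by (rule upper, use A' B' in blast, use A' B' in blast)+
      ultimately show ?thesis by (auto simp: ennreal_neg)
    next
      case False
      then have "ennreal (\<tau> A') + ennreal (\<tau> B') = ennreal (\<tau> A' + \<tau> B')" by simp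
      also have "\<tau> A' + \<tau> B' = \<tau> (A' \<union> B')"
        using A' B' AB by (intro signed_measure_Un[OF \<tau>, symmetric]) auto
      also have "ennreal \<dots> \<le> ?P (A \<union> B)" using A' B' by (intro upper) auto
      finally show ?thesis .
    qed
    then have "(SUP A'\<in>{A' \<in> sets M. A' \<subseteq> A}. ennreal (\<tau> A') + ennreal (\<tau> B')) \<le> ?P (A \<union> B)"
      if "B' \<in> sets M" "B' \<subseteq> B" for B' using that by (intro SUP_least) auto
    then have "ennreal (\<tau> B') + ?P A \<le> ?P (A \<union> B)" if "B' \<in> sets M" "B' \<subseteq> B" for B'
      using that by (subst (asm) ennreal_SUP_add_left) (auto simp: add.commute)
    then have "(SUP B'\<in>{B' \<in> sets M. B' \<subseteq> B}. ennreal (\<tau> B') + ?P A) \<le> ?P (A \<union> B)"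
      by (intro SUP_least) auto
    then show ?thesis
      by (subst (asm) ennreal_SUP_add_left) (auto simp: add.commute)
  qed
  fix A :: "nat \<Rightarrow> 'a set"
  assume A: "range A \<subseteq> sets M" and disj: "disjoint_family A" and U: "(\<Union>i. A i) \<in> sets M"
  have P0: "?P {} = 0"
  proof -
    have "{B \<in> sets M. B \<subseteq> {}} = {{}}" by auto
    then show ?thesis using \<tau> by (simp add: signed_measure_def)
  qed
  show "(\<Sum>i. ?P (A i)) = ?P (\<Union>i. A i)"
  proof (rule antisym)
    have fin: "(\<Sum>i<n. ?P (A i)) \<le> ?P (\<Union>i<n. A i)" for n
    proof (induction n)
      case (Suc n)
      have "(\<Sum>i<Suc n. ?P (A i)) \<le> ?P (\<Union>i<n. A i) + ?P (A n)"
        using Suc by (simp add: add_right_mono)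
      also have "\<dots> \<le> ?P ((\<Union>i<n. A i) \<union> A n)"
      proof (intro super)
        have "A i \<inter> A n = {}" if "i < n" for i
          using that by (intro disjoint_family_onD[OF disj]) auto
        then show "(\<Union>i<n. A i) \<inter> A n = {}" by blast
      qed (use A in auto)
      also have "(\<Union>i<n. A i) \<union> A n = (\<Union>i<Suc n. A i)" by (auto simp: less_Suc_eq)
      finally show ?case .
    qed (simp add: P0)
    show "(\<Sum>i. ?P (A i)) \<le> ?P (\<Union>i. A i)"
      by (rule suminf_le_const[OF summableI]) (rule order_trans[OF fin mono], auto)
  next
    show "?P (\<Union>i. A i) \<le> (\<Sum>i. ?P (A i))"
    proof (rule SUP_least, clarsimp)
      fix B assume B: "B \<in> sets M" "B \<subseteq> (\<Union>i. A i)"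
      have "(\<lambda>i. \<tau> (B \<inter> A i)) sums \<tau> (\<Union>i. B \<inter> A i)"
      proof -
        have "range (\<lambda>i. B \<inter> A i) \<subseteq> sets M" "disjoint_family (\<lambda>i. B \<inter> A i)"
          using A B by (auto intro: disjoint_family_subset[OF disj])
        then show ?thesis using \<tau> unfolding signed_measure_def by blast
      qed
      moreover have "(\<Union>i. B \<inter> A i) = B" using B by auto
      ultimately have "(\<lambda>n. \<Sum>i<n. \<tau> (B \<inter> A i)) \<longlonglongrightarrow> \<tau> B" by (simp add: sums_def)
      then have "(\<lambda>n. ennreal (\<Sum>i<n. \<tau> (B \<inter> A i))) \<longlonglongrightarrow> ennreal (\<tau> B)" by (rule tendsto_ennrealI)
      moreover have "ennreal (\<Sum>i<n. \<tau> (B \<inter> A i)) \<le> (\<Sum>i. ?P (A i))" for n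
      proof -
        have "ennreal (\<Sum>i<n. \<tau> (B \<inter> A i)) \<le> ennreal (\<Sum>i<n. max 0 (\<tau> (B \<inter> A i)))"
          by (intro ennreal_leI sum_mono) auto
        also have "\<dots> = (\<Sum>i<n. ennreal (\<tau> (B \<inter> A i)))"
          by (subst sum_ennreal[symmetric]) (auto simp: ennreal_max_0 intro!: sum.cong)
        also have "\<dots> \<le> (\<Sum>i<n. ?P (A i))"
          using A B by (intro sum_mono upper) auto
        also have "\<dots> \<le> (\<Sum>i. ?P (A i))" by (intro sum_le_suminf summableI) auto
        finally show ?thesis .
      qed
      ultimately show "ennreal (\<tau> B) \<le> (\<Sum>i. ?P (A i))"
        by (intro LIMSEQ_le_const2) auto
    qed
  qed
qed

lemma emeasure_positive_variation:
  assumes \<tau>: "signed_measure M \<tau>" and "A \<in> sets M"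
  shows "emeasure (positive_variation M \<tau>) A = (SUP B\<in>{B \<in> sets M. B \<subseteq> A}. ennreal (\<tau> B))"
  unfolding positive_variation_def
proof (rule emeasure_measure_of_sigma)
  have "{B \<in> sets M. B \<subseteq> {}} = {{}}" by auto
  then show "positive (sets M) (\<lambda>A. SUP B\<in>{B \<in> sets M. B \<subseteq> A}. ennreal (\<tau> B))"
    using \<tau> by (simp add: positive_def signed_measure_def)
qed (use assms countably_additive_positive_variation[OF \<tau>] sets.sigma_algebra_axioms in auto)

lemma finite_measure_positive_variation:
  assumes \<tau>: "signed_measure M \<tau>"
  shows "finite_measure (positive_variation M \<tau>)"
proof (rule finite_measureI)
  obtain K where "\<And>A. A \<in> sets M \<Longrightarrow> \<tau> A \<le> K" using signed_measure_bounded[OF \<tau>] by blast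
  then have "emeasure (positive_variation M \<tau>) (space M) \<le> ennreal K"
    by (subst emeasure_positive_variation[OF \<tau>]) (auto intro!: SUP_least ennreal_leI)
  then show "emeasure (positive_variation M \<tau>) (space (positive_variation M \<tau>)) \<noteq> \<infinity>"
    by (auto simp: top_unique)
qed

lemma finite_measure_negative_variation:
  "signed_measure M \<tau> \<Longrightarrow> finite_measure (negative_variation M \<tau>)"
  unfolding negative_variation_def
  by (intro finite_measure_positive_variation signed_measure_uminus)

text \<open>Complementation \<open>B \<mapsto> A - B\<close> gives \<open>\<tau> B - \<tau> A = - \<tau> (A - B)\<close>, a competitor for the negative
  variation. The terms \<open>ennreal (\<tau> A)\<close> and \<open>ennreal (- \<tau> A)\<close> are the two parts of \<open>\<tau> A\<close>, placed so
  that all quantities stay nonnegative. The reverse inequality is this one for \<open>- \<tau>\<close>.\<close>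

lemma jordan_decomposition_le:
  assumes \<tau>: "signed_measure M \<tau>" and A: "A \<in> sets M"
  shows "emeasure (positive_variation M \<tau>) A + ennreal (- \<tau> A)
       \<le> emeasure (negative_variation M \<tau>) A + ennreal (\<tau> A)"
proof -
  note neg = signed_measure_uminus[OF \<tau>]
  have upper: "ennreal (- \<tau> B) \<le> emeasure (negative_variation M \<tau>) A" if "B \<in> sets M" "B \<subseteq> A" for B
    unfolding negative_variation_def emeasure_positive_variation[OF neg A]
    by (rule SUP_upper) (use that in simp)
  have "ennreal (\<tau> B) + ennreal (- \<tau> A) \<le> emeasure (negative_variation M \<tau>) A + ennreal (\<tau> A)"
    if B: "B \<in> sets M" "B \<subseteq> A" for B
  proof (cases "\<tau> B \<le> 0")
    case True
    then show ?thesis using upper[OF A] by (simp add: ennreal_neg add_increasing2)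
  next
    case False
    \<comment> \<open>The sign of \<open>\<tau> A\<close> decides which of the two truncated terms survives.\<close>
    have "ennreal (\<tau> B) + ennreal (- \<tau> A) \<le> ennreal (- (\<tau> A - \<tau> B)) + ennreal (\<tau> A)"
    proof (cases "\<tau> A \<ge> 0")
      case True
      have "ennreal (\<tau> B) \<le> ennreal (max 0 (\<tau> B - \<tau> A) + \<tau> A)" by (rule ennreal_leI) auto
      also have "\<dots> = ennreal (max 0 (\<tau> B - \<tau> A)) + ennreal (\<tau> A)" using True by (intro ennreal_plus) auto
      finally show ?thesis using True by (simp add: ennreal_neg ennreal_max_0)
    next
      case A0: False
      then have "ennreal (\<tau> B) + ennreal (- \<tau> A) = ennreal (\<tau> B - \<tau> A)"
        using False by (subst ennreal_plus[symmetric]) auto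
      then show ?thesis using A0 by (simp add: ennreal_neg)
    qed
    also have "\<tau> A - \<tau> B = \<tau> (A - B)"
      using signed_measure_Diff[OF \<tau> A] B by simp
    also have "ennreal (- \<tau> (A - B)) \<le> emeasure (negative_variation M \<tau>) A"
      using A B by (intro upper) auto
    finally show ?thesis by (simp add: add_right_mono)
  qed
  then show ?thesis
    unfolding emeasure_positive_variation[OF \<tau> A]
    by (subst ennreal_SUP_add_left[symmetric]) (auto intro!: SUP_least)
qed

lemma jordan_decomposition:
  assumes \<tau>: "signed_measure M \<tau>" and A: "A \<in> sets M"
  shows "\<tau> A = measure (positive_variation M \<tau>) A - measure (negative_variation M \<tau>) A"
proof -
  interpret P: finite_measure "positive_variation M \<tau>" by (rule finite_measure_positive_variation[OF \<tau>])
  interpret N: finite_measure "negative_variation M \<tau>" by (rule finite_measure_negative_variation[OF \<tau>])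
  have "negative_variation M (\<lambda>A. - \<tau> A) = positive_variation M \<tau>"
    by (simp add: negative_variation_def)
  then have "emeasure (positive_variation M \<tau>) A + ennreal (- \<tau> A)
       = emeasure (negative_variation M \<tau>) A + ennreal (\<tau> A)"
    using jordan_decomposition_le[OF \<tau> A] jordan_decomposition_le[OF signed_measure_uminus[OF \<tau>] A]
    by (intro antisym) (simp_all add: negative_variation_def)
  then have "ennreal (measure (positive_variation M \<tau>) A) + ennreal (max 0 (- \<tau> A))
      = ennreal (measure (negative_variation M \<tau>) A) + ennreal (max 0 (\<tau> A))"
    by (simp add: P.emeasure_eq_measure N.emeasure_eq_measure ennreal_max_0)
  then have "measure (positive_variation M \<tau>) A + max 0 (- \<tau> A)
      = measure (negative_variation M \<tau>) A + max 0 (\<tau> A)"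
    by (simp flip: ennreal_plus)
  then show ?thesis by (auto simp: max_def split: if_splits)
qed

section \<open>Integration against signed measures\<close>

text \<open>Integration is additive in the measure, so an identity between sums of measures extends from
  sets to nonnegative functions by approximation with simple functions. Four measures are kept apart
  so that no sum of measures has to be constructed.\<close>

lemma nn_integral_add_measures_cong:
  assumes sets: "sets M1 = sets M" "sets M2 = sets M" "sets M3 = sets M" "sets M4 = sets M"
    and eq: "\<And>A. A \<in> sets M \<Longrightarrow> emeasure M1 A + emeasure M2 A = emeasure M3 A + emeasure M4 A"
    and f: "f \<in> borel_measurable M"
  shows "integral\<^sup>N M1 f + integral\<^sup>N M2 f = integral\<^sup>N M3 f + integral\<^sup>N M4 f"
  using f
proof induction
  case (cong f g)
  have "integral\<^sup>N N f = integral\<^sup>N N g" if "sets N = sets M" for N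
    using cong(3) sets_eq_imp_space_eq[OF that] by (intro nn_integral_cong) auto
  then show ?case using cong sets by simp
next
  case (set A)
  then show ?case using eq sets by simp
next
  case (mult u c)
  have "integral\<^sup>N N (\<lambda>x. c * u x) = c * integral\<^sup>N N u" if "sets N = sets M" for N
    using mult by (intro nn_integral_cmult) (simp add: measurable_cong_sets[OF that refl])
  then show ?case using mult sets by (simp add: distrib_left[symmetric])
next
  case (add u v)
  have "integral\<^sup>N N (\<lambda>x. v x + u x) = integral\<^sup>N N v + integral\<^sup>N N u" if "sets N = sets M" for N
    using add by (intro nn_integral_add) (simp_all add: measurable_cong_sets[OF that refl])
  then have "integral\<^sup>N M1 (\<lambda>x. v x + u x) + integral\<^sup>N M2 (\<lambda>x. v x + u x)
      = (integral\<^sup>N M1 v + integral\<^sup>N M2 v) + (integral\<^sup>N M1 u + integral\<^sup>N M2 u)"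
    and "integral\<^sup>N M3 (\<lambda>x. v x + u x) + integral\<^sup>N M4 (\<lambda>x. v x + u x)
      = (integral\<^sup>N M3 v + integral\<^sup>N M4 v) + (integral\<^sup>N M3 u + integral\<^sup>N M4 u)"
    using sets by (simp_all add: ac_simps)
  then show ?case using add by simp
next
  case (seq U)
  have "(\<lambda>i. integral\<^sup>N N (U i)) \<longlonglongrightarrow> integral\<^sup>N N (SUP i. U i)" if "sets N = sets M" for N
  proof -
    have "(SUP i. U i) = (\<lambda>x. SUP i. U i x)" by (rule ext) (rule SUP_apply)
    moreover have "integral\<^sup>N N (\<lambda>x. SUP i. U i x) = (SUP i. integral\<^sup>N N (U i))"
      using seq by (intro nn_integral_monotone_convergence_SUP) (simp_all add: measurable_cong_sets[OF that refl])
    moreover have "incseq (\<lambda>i. integral\<^sup>N N (U i))"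
      using seq by (auto simp: incseq_def le_fun_def intro!: nn_integral_mono)
    ultimately show ?thesis using LIMSEQ_SUP by metis
  qed
  then have l1: "(\<lambda>i. integral\<^sup>N M1 (U i) + integral\<^sup>N M2 (U i))
        \<longlonglongrightarrow> integral\<^sup>N M1 (SUP i. U i) + integral\<^sup>N M2 (SUP i. U i)"
    and l2: "(\<lambda>i. integral\<^sup>N M3 (U i) + integral\<^sup>N M4 (U i))
        \<longlonglongrightarrow> integral\<^sup>N M3 (SUP i. U i) + integral\<^sup>N M4 (SUP i. U i)"
    using sets by (auto intro!: tendsto_add)
  show ?case by (rule LIMSEQ_unique[OF l1[unfolded seq.IH] l2])
qed

lemma signed_measure_diff_finite_measures:
  assumes "finite_measure \<mu>" "finite_measure \<nu>" "sets \<mu> = sets M" "sets \<nu> = sets M"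
    and "\<And>A. A \<in> sets M \<Longrightarrow> \<tau> A = measure \<mu> A - measure \<nu> A"
  shows "signed_measure M \<tau>"
  unfolding signed_measure_def
proof safe
  show "\<tau> {} = 0" by (simp add: assms(5))
next
  fix A :: "nat \<Rightarrow> 'a set" assume A: "range A \<subseteq> sets M" "disjoint_family A"
  have "(\<lambda>i. measure \<mu> (A i) - measure \<nu> (A i)) sums (measure \<mu> (\<Union>i. A i) - measure \<nu> (\<Union>i. A i))"
    using A assms by (intro sums_diff finite_measure.finite_measure_UNION) auto
  moreover have "A i \<in> sets M" for i using A by auto
  ultimately show "(\<lambda>i. \<tau> (A i)) sums \<tau> (\<Union>i. A i)" by (simp add: assms(5))
qed

text \<open>\<open>\<mu> - \<nu> = \<tau>\<^sup>+ - \<tau>\<^sup>-\<close> rearranges to \<open>\<tau>\<^sup>+ + \<nu> = \<tau>\<^sup>- + \<mu>\<close>, to which additivity in the measure applies.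
  Thus the variations need not be identified to compute a signed integral.\<close>

lemma signed_integral_diff_finite_measures:
  fixes f :: "'a \<Rightarrow> real"
  assumes fin: "finite_measure \<mu>" "finite_measure \<nu>" and sets: "sets \<mu> = sets M" "sets \<nu> = sets M"
    and \<tau>: "\<And>A. A \<in> sets M \<Longrightarrow> \<tau> A = measure \<mu> A - measure \<nu> A"
    and f: "f \<in> borel_measurable M" "\<And>x. x \<in> space M \<Longrightarrow> 0 \<le> f x" "\<And>x. x \<in> space M \<Longrightarrow> f x \<le> B"
  shows "signed_integral M \<tau> f = (LINT x|\<mu>. f x) - (LINT x|\<nu>. f x)"
proof -
  have sm: "signed_measure M \<tau>" using signed_measure_diff_finite_measures[OF fin sets \<tau>] .
  let ?P = "positive_variation M \<tau>" and ?N = "negative_variation M \<tau>"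
  interpret P: finite_measure ?P by (rule finite_measure_positive_variation[OF sm])
  interpret N: finite_measure ?N by (rule finite_measure_negative_variation[OF sm])
  interpret \<mu>: finite_measure \<mu> by fact
  interpret \<nu>: finite_measure \<nu> by fact
  have *: "integral\<^sup>N N f = ennreal (LINT x|N. f x)" "(LINT x|N. f x) \<ge> 0"
    if "finite_measure N" "sets N = sets M" for N
  proof -
    interpret finite_measure N by fact
    have sp: "space N = space M" by (rule sets_eq_imp_space_eq[OF that(2)])
    have "integrable N f"
      using f by (intro integrable_const_bound[of _ B] AE_I2)
        (auto simp: sp measurable_cong_sets[OF that(2) refl])
    then show "integral\<^sup>N N f = ennreal (LINT x|N. f x)"
      using f by (intro nn_integral_eq_integral AE_I2) (auto simp: sp)
    show "(LINT x|N. f x) \<ge> 0" using f by (intro Bochner_Integration.integral_nonneg) (auto simp: sp)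
  qed
  have "integral\<^sup>N ?P f + integral\<^sup>N \<nu> f = integral\<^sup>N ?N f + integral\<^sup>N \<mu> f"
  proof (rule nn_integral_add_measures_cong[where M = M])
    fix A assume "A \<in> sets M"
    then have "measure ?P A + measure \<nu> A = measure ?N A + measure \<mu> A"
      using jordan_decomposition[OF sm, of A] \<tau>[of A] by linarith
    then show "emeasure ?P A + emeasure \<nu> A = emeasure ?N A + emeasure \<mu> A"
      by (simp add: P.emeasure_eq_measure N.emeasure_eq_measure \<mu>.emeasure_eq_measure
          \<nu>.emeasure_eq_measure flip: ennreal_plus)
  qed (use sets f(1) in auto)
  moreover have nn: "0 \<le> (LINT x|?P. f x)" "0 \<le> (LINT x|?N. f x)" "0 \<le> (LINT x|\<mu>. f x)" "0 \<le> (LINT x|\<nu>. f x)"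
    by (rule *(2); (fact | simp add: sets P.finite_measure_axioms N.finite_measure_axioms))+
  ultimately have "(LINT x|?P. f x) + (LINT x|\<nu>. f x) = (LINT x|?N. f x) + (LINT x|\<mu>. f x)"
    by (simp add: *(1) sets fin P.finite_measure_axioms N.finite_measure_axioms flip: ennreal_plus)
  then show ?thesis by (simp add: signed_integral_def)
qed

lemma space_borel_unit: "space borel_unit = {0..1}"
  by (simp add: space_restrict_space)

lemma bounded_functional_integral:
  assumes "finite_measure \<mu>" and sets: "sets \<mu> = sets borel_unit"
  shows "bounded_functional (measure \<mu> (space \<mu>)) (\<lambda>f. LINT x|\<mu>. f x)"
proof -
  interpret finite_measure \<mu> by fact
  have sp: "space \<mu> = {0..1}" using sets_eq_imp_space_eq[OF sets] by (simp add: space_restrict_space)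
  have meas: "f \<in> borel_measurable \<mu>" if "continuous_on {0..1} f" for f :: "real \<Rightarrow> real"
    using borel_measurable_continuous_on_restrict[OF that] by (simp add: measurable_cong_sets[OF sets refl])
  have int: "integrable \<mu> f" if f: "continuous_on {0..1} f" for f :: "real \<Rightarrow> real"
  proof -
    have "bounded (f ` {0..1})" using f by (intro compact_imp_bounded compact_continuous_image) auto
    then obtain B where "\<forall>z\<in>f ` {0..1}. norm z \<le> B" unfolding bounded_iff by blast
    then show ?thesis
      using meas[OF f] by (intro integrable_const_bound[of _ B] AE_I2) (auto simp: sp)
  qed
  show ?thesis
    unfolding bounded_functional_def
  proof (intro conjI allI impI)
    fix f :: "real \<Rightarrow> real" and B assume f: "continuous_on {0..1} f" and B: "\<forall>x\<in>{0..1}. \<bar>f x\<bar> \<le> B"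
    have "norm (LINT x|\<mu>. f x) \<le> (LINT x|\<mu>. norm (f x))" by (rule integral_norm_bound)
    also have "\<dots> \<le> (LINT x|\<mu>. B)"
      using int[OF f] B by (intro integral_mono) (auto simp: sp)
    finally show "\<bar>LINT x|\<mu>. f x\<bar> \<le> measure \<mu> (space \<mu>) * B" by simp
  qed (simp_all add: int)
qed

lemma bounded_functional_minus:
  assumes "bounded_functional C L" "bounded_functional C' L'"
  shows "bounded_functional (C + C') (\<lambda>f. L f - L' f)"
  unfolding bounded_functional_def
proof (intro conjI allI impI)
  fix f :: "real \<Rightarrow> real" and B assume "continuous_on {0..1} f" "\<forall>x\<in>{0..1}. \<bar>f x\<bar> \<le> B"
  then have "\<bar>L f\<bar> \<le> C * B" "\<bar>L' f\<bar> \<le> C' * B"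
    using assms unfolding bounded_functional_def by blast+
  then show "\<bar>L f - L' f\<bar> \<le> (C + C') * B" by (simp add: distrib_right)
qed (use assms in \<open>simp_all add: bounded_functional_def right_diff_distrib\<close>)

lemma bounded_functional_signed_integral:
  assumes "signed_measure borel_unit \<tau>"
  obtains C where "bounded_functional C (signed_integral borel_unit \<tau>)"
proof -
  have "bounded_functional (measure (positive_variation borel_unit \<tau>) (space (positive_variation borel_unit \<tau>))
          + measure (negative_variation borel_unit \<tau>) (space (negative_variation borel_unit \<tau>)))
        (\<lambda>f. signed_integral borel_unit \<tau> f)"
    unfolding signed_integral_def
    by (intro bounded_functional_minus bounded_functional_integral
        finite_measure_positive_variation finite_measure_negative_variation assms
        sets_positive_variation sets_negative_variation)
  then show ?thesis using that by simp
qed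

text \<open>The difference of the two functionals has vanishing moments, in particular totally monotone
  ones, so it is nonnegative on nonnegative functions.\<close>

lemma signed_hausdorff_rep_integral_le:
  assumes \<sigma>: "signed_hausdorff_rep \<sigma> d" and \<tau>: "signed_hausdorff_rep \<tau> d"
    and f: "continuous_on {0..1} f" "\<And>x. x \<in> {0..1} \<Longrightarrow> f x \<ge> 0"
  shows "signed_integral borel_unit \<sigma> f \<le> signed_integral borel_unit \<tau> f"
proof -
  obtain C C' where "bounded_functional C (signed_integral borel_unit \<sigma>)"
    "bounded_functional C' (signed_integral borel_unit \<tau>)"
    using \<sigma> \<tau> bounded_functional_signed_integral unfolding signed_hausdorff_rep_def by metis
  then have L: "bounded_functional (C' + C) (\<lambda>f. signed_integral borel_unit \<tau> f - signed_integral borel_unit \<sigma> f)"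
    by (intro bounded_functional_minus)
  have zero: "(backward_diff ^^ k) (\<lambda>n. 0) = (\<lambda>n. 0)" for k
    by (induction k) (auto simp: backward_diff_def)
  have "(\<lambda>n. signed_integral borel_unit \<tau> (\<lambda>x. x ^ n) - signed_integral borel_unit \<sigma> (\<lambda>x. x ^ n)) = (\<lambda>n. 0)"
    using \<sigma> \<tau> by (simp add: signed_hausdorff_rep_def)
  then show ?thesis
    using totally_monotone_functional_nonneg[OF L _ f] by (simp add: zero)
qed

lemma signed_integral_indicator:
  assumes "signed_measure M \<tau>" "A \<inter> space M \<in> sets M"
  shows "signed_integral M \<tau> (indicator A) = \<tau> (A \<inter> space M)"
  unfolding signed_integral_def jordan_decomposition[OF assms] by (simp add: Int_commute)

text \<open>Continuous ramps of slope \<open>- k\<close> to the right of \<open>a\<close> decrease to the indicator of \<open>{..a}\<close>, with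
  common bound 1.\<close>

lemma tent_tendsto_indicator_atMost:
  fixes a s :: real
  shows "(\<lambda>k. max 0 (min 1 (1 - real k * (s - a)))) \<longlonglongrightarrow> indicator {..a} s"
proof (cases "s \<le> a")
  case True
  then have "real k * (s - a) \<le> 0" for k by (simp add: mult_le_0_iff)
  then have "(\<lambda>k. max 0 (min 1 (1 - real k * (s - a)))) = (\<lambda>k. 1)" by (auto simp: min_def max_def)
  then show ?thesis using True by simp
next
  case False
  obtain K :: nat where K: "1 / (s - a) \<le> K" using real_arch_simple by blast
  have "max 0 (min 1 (1 - real k * (s - a))) = 0" if "k \<ge> K" for k
  proof -
    have "1 / (s - a) \<le> real k" using K that by linarith
    then show ?thesis using False by (simp add: divide_le_eq max_def min_def)
  qed
  then have "(\<lambda>k. max 0 (min 1 (1 - real k * (s - a)))) \<longlonglongrightarrow> 0"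
    by (intro tendsto_eventually) (auto simp: eventually_sequentially)
  then show ?thesis using False by simp
qed

lemma signed_integral_tent_tendsto:
  assumes \<tau>: "signed_measure borel_unit \<tau>"
  shows "(\<lambda>k. signed_integral borel_unit \<tau> (\<lambda>s. max 0 (min 1 (1 - real k * (s - a)))))
           \<longlonglongrightarrow> \<tau> ({..a} \<inter> {0..1})"
proof -
  let ?f = "\<lambda>k s. max 0 (min 1 (1 - real k * (s - a)))"
  have lim: "(\<lambda>k. LINT s|\<mu>. ?f k s) \<longlonglongrightarrow> (LINT s|\<mu>. indicator {..a} s)"
    if "finite_measure \<mu>" and sets: "sets \<mu> = sets borel_unit" for \<mu>
  proof -
    interpret finite_measure \<mu> by fact
    have meas: "f \<in> borel_measurable \<mu>" if "f \<in> borel_measurable borel" for f :: "real \<Rightarrow> real"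
      using that by (simp add: measurable_cong_sets[OF sets refl] measurable_restrict_space1)
    show ?thesis
      by (rule integral_dominated_convergence[where w = "\<lambda>_. 1"])
        (auto intro!: meas tent_tendsto_indicator_atMost)
  qed
  have "(\<lambda>k. signed_integral borel_unit \<tau> (?f k)) \<longlonglongrightarrow> signed_integral borel_unit \<tau> (indicator {..a})"
    unfolding signed_integral_def
    by (intro tendsto_diff lim) (auto intro: finite_measure_positive_variation finite_measure_negative_variation \<tau>)
  also have "signed_integral borel_unit \<tau> (indicator {..a}) = \<tau> ({..a} \<inter> {0..1})"
    by (subst signed_integral_indicator[OF \<tau>]) (auto simp: space_borel_unit sets_restrict_space)
  finally show ?thesis .
qed

text \<open>Equal moments give equal integrals of continuous functions, hence, through the ramps, equal
  values on the intervals \<open>{..a} \<inter> {0..1}\<close>. These form an intersection-stable generator, and the sets on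
  which two signed measures agree form a Dynkin system.\<close>

lemma signed_hausdorff_rep_unique:
  assumes \<sigma>: "signed_hausdorff_rep \<sigma> d" and \<tau>: "signed_hausdorff_rep \<tau> d" and A: "A \<in> sets borel_unit"
  shows "\<tau> A = \<sigma> A"
proof -
  have s\<sigma>: "signed_measure borel_unit \<sigma>" and s\<tau>: "signed_measure borel_unit \<tau>"
    using \<sigma> \<tau> by (auto simp: signed_hausdorff_rep_def)
  have atMost: "\<tau> ({..a} \<inter> {0..1}) = \<sigma> ({..a} \<inter> {0..1})" for a
  proof -
    have "signed_integral borel_unit \<tau> (\<lambda>s. max 0 (min 1 (1 - real k * (s - a))))
        = signed_integral borel_unit \<sigma> (\<lambda>s. max 0 (min 1 (1 - real k * (s - a))))" for k
      by (intro antisym signed_hausdorff_rep_integral_le[OF \<tau> \<sigma>] signed_hausdorff_rep_integral_le[OF \<sigma> \<tau>])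
        (auto intro!: continuous_intros)
    then show ?thesis
      using signed_integral_tent_tendsto[OF s\<tau>, of a] signed_integral_tent_tendsto[OF s\<sigma>, of a]
      by (simp add: LIMSEQ_unique)
  qed
  have unit: "B \<inter> {0..1} \<in> sets borel_unit" if "B \<in> sets borel" for B
    using that by (auto simp: sets_restrict_space)
  have "\<tau> (B \<inter> {0..1}) = \<sigma> (B \<inter> {0..1})" if B: "B \<in> sets borel" for B :: "real set"
  proof -
    have gen: "sets borel = sigma_sets UNIV (range (\<lambda>a::real. {..a}))"
      by (subst borel_eq_atMost) simp
    have stable: "Int_stable (range (\<lambda>a::real. {..a}))"
      unfolding Int_stable_def by auto
    have closed: "range (\<lambda>a::real. {..a}) \<subseteq> Pow UNIV" by simp
    from stable closed B[unfolded gen] show ?thesis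
    proof (induction rule: sigma_sets_induct_disjoint)
      case (compl B)
      have "(UNIV - B) \<inter> {0..1} = ({..1} \<inter> {0..1}) - (B \<inter> {0..1})" by auto
      then show ?case
        using signed_measure_Diff[OF s\<tau> unit[of "{..1}"] unit[of B]]
          signed_measure_Diff[OF s\<sigma> unit[of "{..1}"] unit[of B]] compl atMost[of 1]
        by (simp add: gen[symmetric] Int_absorb1)
    next
      case (union B)
      have fam: "range (\<lambda>i. B i \<inter> {0..1}) \<subseteq> sets borel_unit" "disjoint_family (\<lambda>i. B i \<inter> {0..1})"
        using union unit by (auto simp: gen[symmetric] intro: disjoint_family_subset[OF union(1)])
      then have "(\<lambda>i. \<tau> (B i \<inter> {0..1})) sums \<tau> (\<Union>i. B i \<inter> {0..1})"
        "(\<lambda>i. \<sigma> (B i \<inter> {0..1})) sums \<sigma> (\<Union>i. B i \<inter> {0..1})"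
        using s\<tau> s\<sigma> unfolding signed_measure_def by blast+
      moreover have "(\<Union>i. B i \<inter> {0..1}) = (\<Union>i. B i) \<inter> {0..1}" by auto
      ultimately show ?case using union.IH by (simp add: sums_unique2)
    qed (use atMost s\<tau> s\<sigma> in \<open>auto simp: signed_measure_def\<close>)
  qed
  moreover obtain B where "B \<in> sets borel" "A = B \<inter> {0..1}"
    using A by (auto simp: sets_restrict_space)
  ultimately show ?thesis by simp
qed

definition discrete_measure :: "'a measure \<Rightarrow> (nat \<Rightarrow> real) \<Rightarrow> (nat \<Rightarrow> 'a) \<Rightarrow> 'a measure" where
  "discrete_measure M w x = distr (density (count_space UNIV) (\<lambda>m. ennreal (w m))) M x"

lemma integral_discrete_measure:
  fixes f :: "'a \<Rightarrow> real"
  assumes w: "\<And>m. w m \<ge> 0" "summable w" and x: "\<And>m. x m \<in> space M"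
    and f: "f \<in> borel_measurable M" "\<And>m. \<bar>f (x m)\<bar> \<le> B"
  shows "(LINT y|discrete_measure M w x. f y) = (\<Sum>m. w m * f (x m))"
proof -
  have meas: "x \<in> measurable (density (count_space UNIV) (\<lambda>m. ennreal (w m))) M"
    using x by simp
  have "(LINT y|discrete_measure M w x. f y) = (LINT m|density (count_space UNIV) (\<lambda>m. ennreal (w m)). f (x m))"
    unfolding discrete_measure_def by (rule integral_distr[OF meas f(1)])
  also have "\<dots> = (LINT m|count_space UNIV. w m *\<^sub>R f (x m))"
    using w by (intro integral_density) auto
  also have "\<dots> = (\<Sum>m. w m * f (x m))"
  proof (subst integral_count_space_nat)
    have "summable (\<lambda>m. w m * \<bar>f (x m)\<bar>)"
      using w f by (intro summable_weighted(1)) auto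
    then show "integrable (count_space UNIV) (\<lambda>m. w m *\<^sub>R f (x m))"
      using w by (simp add: integrable_count_space_nat_iff abs_mult)
  qed simp
  finally show ?thesis .
qed

lemma finite_measure_discrete_measure:
  assumes "\<And>m. w m \<ge> 0" "summable w" "\<And>m. x m \<in> space M"
  shows "finite_measure (discrete_measure M w x)"
proof (rule finite_measureI)
  have "x -` space M = UNIV" using assms(3) by auto
  then have "emeasure (discrete_measure M w x) (space (discrete_measure M w x)) = (\<Sum>m. ennreal (w m))"
    using assms(3) unfolding discrete_measure_def
    by (simp add: emeasure_distr emeasure_density nn_integral_count_space_nat)
  then show "emeasure (discrete_measure M w x) (space (discrete_measure M w x)) \<noteq> \<infinity>"
    by (simp add: suminf_ennreal2 assms)
qed

text \<open>The positive and negative parts of the weights give two finite measures with the right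
  difference. They need not be the variations, since nodes may coincide.\<close>

lemma signed_hausdorff_rep_discrete:
  fixes w x :: "nat \<Rightarrow> real"
  assumes w: "summable (\<lambda>m. \<bar>w m\<bar>)" and x: "\<And>m. x m \<in> {0..1}"
  shows "signed_hausdorff_rep (\<lambda>A. \<Sum>m. w m * indicator A (x m)) (\<lambda>n. \<Sum>m. w m * x m ^ n)"
proof -
  let ?\<mu> = "discrete_measure borel_unit (\<lambda>m. max 0 (w m)) x"
  let ?\<nu> = "discrete_measure borel_unit (\<lambda>m. max 0 (- w m)) x"
  have pos: "summable (\<lambda>m. max 0 (w m))" and neg: "summable (\<lambda>m. max 0 (- w m))"
    by (rule summable_comparison_test'[OF w, of 0]; simp)+
  have x': "x m \<in> space borel_unit" for m using x by (simp add: space_borel_unit)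
  have fin: "finite_measure ?\<mu>" "finite_measure ?\<nu>"
    by (auto intro!: finite_measure_discrete_measure pos neg x')
  have sets: "sets ?\<mu> = sets borel_unit" "sets ?\<nu> = sets borel_unit"
    by (simp_all add: discrete_measure_def)
  have int: "(LINT y|?\<mu>. f y) - (LINT y|?\<nu>. f y) = (\<Sum>m. w m * f (x m))"
    if f: "f \<in> borel_measurable borel_unit" "\<And>y. y \<in> {0..1} \<Longrightarrow> \<bar>f y\<bar> \<le> 1" for f
  proof -
    have b: "\<bar>f (x m)\<bar> \<le> 1" for m using f(2) x by blast
    have "(\<Sum>m. w m * f (x m)) = (\<Sum>m. max 0 (w m) * f (x m) - max 0 (- w m) * f (x m))"
      by (intro suminf_cong) (auto simp: max_def)
    also have "\<dots> = (\<Sum>m. max 0 (w m) * f (x m)) - (\<Sum>m. max 0 (- w m) * f (x m))"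
      using pos neg b by (intro suminf_diff[symmetric] summable_weighted(1)[where B = 1]) auto
    also have "(\<Sum>m. max 0 (w m) * f (x m)) = (LINT y|?\<mu>. f y)"
      by (rule integral_discrete_measure[OF _ pos x' f(1) b, symmetric]) simp
    also have "(\<Sum>m. max 0 (- w m) * f (x m)) = (LINT y|?\<nu>. f y)"
      by (rule integral_discrete_measure[OF _ neg x' f(1) b, symmetric]) simp
    finally show ?thesis ..
  qed
  have eq: "(\<Sum>m. w m * indicator A (x m)) = measure ?\<mu> A - measure ?\<nu> A" if "A \<in> sets borel_unit" for A
  proof -
    have "A \<inter> space ?\<mu> = A" "A \<inter> space ?\<nu> = A"
      using that sets.sets_into_space[of A] sets by (metis Int_absorb2)+
    moreover have "(LINT y|?\<mu>. indicator A y) - (LINT y|?\<nu>. indicator A y) = (\<Sum>m. w m * indicator A (x m))"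
      using that by (intro int) (auto simp: indicator_def)
    ultimately show ?thesis by simp
  qed
  have "signed_measure borel_unit (\<lambda>A. \<Sum>m. w m * indicator A (x m))"
    by (rule signed_measure_diff_finite_measures[OF fin sets eq])
  moreover have "(\<Sum>m. w m * x m ^ n) = signed_integral borel_unit (\<lambda>A. \<Sum>m. w m * indicator A (x m)) (\<lambda>s. s ^ n)" for n
  proof -
    have meas: "(\<lambda>s::real. s ^ n) \<in> borel_measurable borel_unit"
      by (intro measurable_restrict_space1) simp
    then show ?thesis
      using signed_integral_diff_finite_measures[OF fin sets eq meas, of 1]
        int[of "\<lambda>s. s ^ n"]
      by (simp add: space_borel_unit power_le_one)
  qed
  ultimately show ?thesis by (simp add: signed_hausdorff_rep_def)
qed

section \<open>The interpolation problem\<close>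

lemma bernstein_interpolant_mono:
  assumes "bernstein_interpolant G a"
  shows "a (Suc n) \<le> a (Suc (Suc n))"
  using bernstein_function_increments_totally_monotone[of G 0 n] assms
  unfolding bernstein_interpolant_def by (simp del: of_nat_Suc)

text \<open>The difference of the geometric series of \<open>y / (1 + D y)\<close> at \<open>y = q\<^sup>n\<close> and \<open>y = q\<^sup>n\<^sup>+\<^sup>1\<close>.\<close>

lemma mobius_increment_expansion:
  fixes D q :: real
  assumes q: "0 < q" "q < 1" and D: "\<bar>D\<bar> < 1"
  shows "(\<lambda>m. (1 - q ^ Suc m) * (- D) ^ m * q ^ (Suc m * n)) sums
     (q ^ n / (1 + D * q ^ n) - q ^ Suc n / (1 + D * q ^ Suc n))"
proof -
  have geo: "(\<lambda>m. q ^ k * (- D * q ^ k) ^ m) sums (q ^ k / (1 + D * q ^ k))" for k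
  proof -
    have "\<bar>D\<bar> * q ^ k \<le> \<bar>D\<bar> * 1" using q by (intro mult_left_mono power_le_one) auto
    then have "norm (- D * q ^ k) < 1" using D q by (simp add: abs_mult)
    from sums_mult[OF geometric_sums[OF this], of "q ^ k"] show ?thesis by simp
  qed
  have "(1 - q ^ Suc m) * (- D) ^ m * q ^ (Suc m * n)
      = q ^ n * (- D * q ^ n) ^ m - q ^ Suc n * (- D * q ^ Suc n) ^ m" for m
  proof -
    have eq: "q ^ (Suc m * n) = q ^ n * (q ^ n) ^ m" by (metis mult.commute power_Suc power_mult)
    show ?thesis
      by (simp only: eq power_mult_distrib power_Suc) (simp add: algebra_simps)
  qed
  then show ?thesis using sums_diff[OF geo[of n] geo[of "Suc n"]] by simp
qed

lemma geometric_nodes_isolated: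
  fixes q :: real
  assumes q: "0 < q" "q < 1" and "m \<noteq> j"
  shows "q ^ j - q ^ Suc j \<le> \<bar>q ^ m - q ^ j\<bar>"
proof (cases "m < j")
  case True
  have "q ^ j \<le> q ^ Suc m" using True q by (intro power_decreasing) auto
  moreover have "q ^ j - q ^ Suc j \<le> q ^ m - q ^ Suc m"
  proof -
    have "q ^ j * (1 - q) \<le> q ^ m * (1 - q)" using True q by (intro mult_right_mono power_decreasing) auto
    then show ?thesis by (simp add: algebra_simps)
  qed
  ultimately show ?thesis by linarith
next
  case False
  then have "q ^ m \<le> q ^ Suc j" using assms by (intro power_decreasing) auto
  then show ?thesis by linarith
qed

text \<open>Only the values \<open>a n\<close> with \<open>n \<ge> 1\<close> are values of \<open>G\<close>. The increments from \<open>n = 1\<close> on have the weights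
  \<open>w m q\<^sup>m\<^sup>+\<^sup>1\<close>, which have the same signs, so the shift loses nothing.\<close>

lemma no_bernstein_interpolant_negative_atom:
  fixes w :: "nat \<Rightarrow> real"
  assumes q: "0 < q" "q < 1" and w: "summable (\<lambda>m. \<bar>w m\<bar>)"
    and a: "\<And>n. a (Suc n) - a n = (\<Sum>m. w m * (q ^ Suc m) ^ n)" and neg: "w j < 0"
  shows "\<not> bernstein_interpolant G a"
proof
  assume G: "bernstein_interpolant G a"
  let ?w = "\<lambda>m. w m * q ^ Suc m"
  have "?w j \<ge> 0"
  proof (rule totally_monotone_isolated_weight_nonneg[where w = ?w and x = "\<lambda>m. q ^ Suc m"
        and r = "q ^ Suc j - q ^ Suc (Suc j)"])
    show "summable (\<lambda>m. \<bar>?w m\<bar>)"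
    proof -
      have "summable (\<lambda>m. \<bar>w m\<bar> * q ^ Suc m)"
      proof (rule summable_weighted(1))
        show "\<bar>q ^ Suc m\<bar> \<le> 1" for m using power_le_one[of q "Suc m"] q by (simp add: abs_mult)
      qed (use w in simp)
      then show ?thesis using q by (simp add: abs_mult)
    qed
    show "q ^ Suc m \<in> {0..1}" for m using q power_le_one[of q "Suc m"] by simp
    show "0 < q ^ Suc j - q ^ Suc (Suc j)" using q by simp
    show "q ^ Suc j - q ^ Suc (Suc j) \<le> \<bar>q ^ Suc m - q ^ Suc j\<bar>" if "m \<noteq> j" for m
      using that by (intro geometric_nodes_isolated q) simp
    have "(\<lambda>n. \<Sum>m. ?w m * (q ^ Suc m) ^ n) = (\<lambda>n. G (real (Suc (Suc n))) - G (real (Suc n)))"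
    proof
      fix n
      have "(\<Sum>m. ?w m * (q ^ Suc m) ^ n) = a (Suc (Suc n)) - a (Suc n)"
        unfolding a by (simp add: mult.assoc)
      then show "(\<Sum>m. ?w m * (q ^ Suc m) ^ n) = G (real (Suc (Suc n))) - G (real (Suc n))"
        using G by (simp add: bernstein_interpolant_def del: of_nat_Suc)
    qed
    then show "(backward_diff ^^ k) (\<lambda>n. \<Sum>m. ?w m * (q ^ Suc m) ^ n) n \<ge> 0" for k n
      using bernstein_function_increments_totally_monotone[of G k n] G
      by (simp add: bernstein_interpolant_def del: of_nat_Suc)
  qed
  moreover have "q ^ Suc j > 0" using q by simp
  ultimately show False using neg by (simp add: zero_le_mult_iff del: power_Suc)
qed

theorem theorem7p1:
  fixes p q c N D :: real
    and a d :: "nat \<Rightarrow> real"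
    and F :: "real \<Rightarrow> real"
    and \<sigma> :: "real set \<Rightarrow> real"
  assumes "p > 1" and "q = inverse p" and "c = ln p"
    and "-1 < N" and "N < 1" and "-1 < D" and "D < 1"
    and "a = (\<lambda>n. (p ^ n + N) / (p ^ n + D))"
    and "d = (\<lambda>n. a (Suc n) - a n)"
    and "F = (\<lambda>x. (1 + N * q powr x) / (1 + D * q powr x))"
    and "\<sigma> = (\<lambda>A. (D - N) * (\<Sum>m. (1 - q ^ Suc m) * (- D) ^ m * indicator A (q ^ Suc m)))"
  shows "((\<exists>G. bernstein_interpolant G a) \<longleftrightarrow> N = D \<or> (N < D \<and> D \<le> 0))
    \<and> (N = D \<longrightarrow> (\<forall>n. a n = 1) \<and> bernstein_interpolant (\<lambda>x. 1) a)
    \<and> (N < D \<and> D \<le> 0 \<longrightarrow>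
         bernstein_interpolant F a
       \<and> (\<forall>x>0.
              (F has_real_derivative
                 c * (D - N) * (exp (- c * x) / (1 + D * exp (- c * x))\<^sup>2)) (at x)
            \<and> summable (\<lambda>m. real (Suc m) * (- D) ^ m * exp (- real (Suc m) * c * x))
            \<and> deriv F x =
                 c * (D - N) * (\<Sum>m. real (Suc m) * (- D) ^ m * exp (- real (Suc m) * c * x)))
       \<and> (\<forall>m. c * (D - N) * (real (Suc m) * (- D) ^ m) \<ge> 0)
       \<and> completely_monotone (deriv F))
    \<and> (N < D \<and> 0 < D \<and> D < 1 \<longrightarrow>
         (\<nexists>G. bernstein_interpolant G a)
       \<and> signed_hausdorff_rep \<sigma> d
       \<and> (\<forall>\<tau>. signed_hausdorff_rep \<tau> d \<longrightarrow> (\<forall>A \<in> sets borel_unit. \<tau> A = \<sigma> A))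
       \<and> (\<forall>n. summable (\<lambda>m. (1 - q ^ Suc m) * (- D) ^ m * q ^ (Suc m * n))
            \<and> d n = (D - N) * (\<Sum>m. (1 - q ^ Suc m) * (- D) ^ m * q ^ (Suc m * n)))
       \<and> \<sigma> {q\<^sup>2} = - (D - N) * D * (1 - q\<^sup>2)
       \<and> \<sigma> {q\<^sup>2} < 0)
    \<and> (N > D \<longrightarrow> (\<forall>m n. m < n \<longrightarrow> a n < a m) \<and> (\<nexists>G. bernstein_interpolant G a))"
proof -
  note p = assms(1) and q_def = assms(2) and c_def = assms(3) and N = assms(4,5) and D = assms(6,7)
    and a_def = assms(8) and d_def = assms(9) and F_def = assms(10) and \<sigma>_def = assms(11)
  have q: "0 < q" "q < 1" using p by (auto simp: q_def inverse_less_1_iff)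
  have c: "c > 0" using p by (simp add: c_def)
  have qpowr: "q powr x = exp (- c * x)" for x
    using p by (simp add: powr_def q_def c_def ln_inverse)
  have pD: "p ^ n + D > 0" for n using one_le_power[of p n] p D by linarith
  have aq: "a n = (1 + N * q ^ n) / (1 + D * q ^ n)" for n
  proof -
    have *: "p ^ n * (1 + M * q ^ n) = p ^ n + M" for M
      using p by (simp add: q_def power_inverse field_simps)
    have "(1 + N * q ^ n) / (1 + D * q ^ n) = (p ^ n * (1 + N * q ^ n)) / (p ^ n * (1 + D * q ^ n))"
      using p by simp
    then show ?thesis unfolding * by (simp add: a_def)
  qed
  have a_diff: "a n = 1 + (N - D) / (p ^ n + D)" for n
    using pD[of n] by (simp add: a_def field_simps)

  have i: "(\<forall>n. a n = 1) \<and> bernstein_interpolant (\<lambda>x. 1) a" if "N = D"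
  proof -
    have a1: "a n = 1" for n using a_diff[of n] that by simp
    have "bernstein_function (\<lambda>x. 1)"
      by (rule bernstein_function_derivative_chainI[where g = "\<lambda>n x. if n = 0 then 1 else 0"])
        (auto simp: derivative_chain_def)
    then show ?thesis using a1 by (simp add: bernstein_interpolant_def)
  qed

  have ii: "bernstein_interpolant F a
       \<and> (\<forall>x>0.
              (F has_real_derivative
                 c * (D - N) * (exp (- c * x) / (1 + D * exp (- c * x))\<^sup>2)) (at x)
            \<and> summable (\<lambda>m. real (Suc m) * (- D) ^ m * exp (- real (Suc m) * c * x))
            \<and> deriv F x =
                 c * (D - N) * (\<Sum>m. real (Suc m) * (- D) ^ m * exp (- real (Suc m) * c * x)))
       \<and> (\<forall>m. c * (D - N) * (real (Suc m) * (- D) ^ m) \<ge> 0)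
       \<and> completely_monotone (deriv F)" if ND: "N < D" "D \<le> 0"
  proof -
    have F: "F x = (1 + N * exp (- c * x)) / (1 + D * exp (- c * x))" for x
      unfolding F_def qpowr ..
    have bern: "bernstein_function F"
      by (rule bernstein_function_mobius_exp(1)[OF c D(1) ND(2) N(1) _ F]) (use ND in simp)
    have F': "(F has_real_derivative c * (D - N) * (exp (- c * x) / (1 + D * exp (- c * x))\<^sup>2)) (at x)"
      if "x > 0" for x
      by (rule bernstein_function_mobius_exp(2)[OF c D(1) ND(2) N(1) _ F that]) (use ND in simp)
    have "isCont F 0" unfolding F using D by (intro continuous_intros) auto
    then have "(F \<longlongrightarrow> F 0) (at_right 0)"
      by (meson isCont_def tendsto_within_subset subset_UNIV)
    moreover have "F 0 = a 0" by (simp add: F aq)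
    moreover have "F (real n) = a n" for n
      using q by (simp add: F_def aq powr_realpow)
    ultimately have interp: "bernstein_interpolant F a" using bern by (simp add: bernstein_interpolant_def)
    have "summable (\<lambda>m. real (Suc m) * (- D) ^ m * exp (- real (Suc m) * c * x))
            \<and> deriv F x = c * (D - N) * (\<Sum>m. real (Suc m) * (- D) ^ m * exp (- real (Suc m) * c * x))"
      if x: "x > 0" for x
    proof -
      have "\<bar>D\<bar> < 1" using D by auto
      from mobius_exp_derivative_series[OF c this x]
      show ?thesis using DERIV_imp_deriv[OF F'[OF x]] by (simp add: sums_iff)
    qed
    moreover have "c * (D - N) * (real (Suc m) * (- D) ^ m) \<ge> 0" for m
      using c ND by (intro mult_nonneg_nonneg zero_le_power) auto
    ultimately show ?thesis using interp F' bern by (simp add: bernstein_function_def)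
  qed

  have iii: "(\<nexists>G. bernstein_interpolant G a)
       \<and> signed_hausdorff_rep \<sigma> d
       \<and> (\<forall>\<tau>. signed_hausdorff_rep \<tau> d \<longrightarrow> (\<forall>A \<in> sets borel_unit. \<tau> A = \<sigma> A))
       \<and> (\<forall>n. summable (\<lambda>m. (1 - q ^ Suc m) * (- D) ^ m * q ^ (Suc m * n))
            \<and> d n = (D - N) * (\<Sum>m. (1 - q ^ Suc m) * (- D) ^ m * q ^ (Suc m * n)))
       \<and> \<sigma> {q\<^sup>2} = - (D - N) * D * (1 - q\<^sup>2)
       \<and> \<sigma> {q\<^sup>2} < 0" if ND: "N < D" "0 < D"
  proof -
    define w where "w m = (D - N) * ((1 - q ^ Suc m) * (- D) ^ m)" for m
    have absD: "\<bar>D\<bar> < 1" using D by auto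
    have smD: "summable (\<lambda>m. (- D) ^ m * g m)" if "\<And>m. \<bar>g m\<bar> \<le> 1" for g :: "nat \<Rightarrow> real"
      using absD that by (intro summable_weighted(1)[where B = 1])
        (simp_all add: power_abs summable_geometric)
    have q1: "\<bar>1 - q ^ Suc m\<bar> \<le> 1" for m using q power_le_one[of q "Suc m"] by (simp add: abs_if)
    have w: "summable (\<lambda>m. \<bar>w m\<bar>)"
    proof -
      have "summable (\<lambda>m. \<bar>(- D) ^ m\<bar> * \<bar>(D - N) * (1 - q ^ Suc m)\<bar>)"
      proof (rule summable_weighted(1))
        show "\<bar>\<bar>(D - N) * (1 - q ^ Suc m)\<bar>\<bar> \<le> \<bar>D - N\<bar>" for m
          using q1[of m] by (simp add: abs_mult mult_left_le)
      qed (use absD in \<open>simp add: power_abs summable_geometric\<close>)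
      then show ?thesis by (simp add: w_def abs_mult mult_ac)
    qed
    have \<sigma>w: "\<sigma> A = (\<Sum>m. w m * indicator A (q ^ Suc m))" for A
    proof -
      have "summable (\<lambda>m. (- D) ^ m * ((1 - q ^ Suc m) * indicator A (q ^ Suc m)))"
        using q1 by (intro smD) (simp add: indicator_def)
      then have "summable (\<lambda>m. (1 - q ^ Suc m) * (- D) ^ m * indicator A (q ^ Suc m))"
        by (simp add: mult_ac)
      from suminf_mult[OF this, of "D - N"] show ?thesis unfolding \<sigma>_def w_def by (simp add: mult.assoc)
    qed
    have expansion: "(\<lambda>m. (1 - q ^ Suc m) * (- D) ^ m * q ^ (Suc m * n)) sums (d n / (D - N))" for n
    proof -
      have "d n / (D - N) = q ^ n / (1 + D * q ^ n) - q ^ Suc n / (1 + D * q ^ Suc n)"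
      proof -
        have "a k = 1 - (D - N) * (q ^ k / (1 + D * q ^ k))" for k
        proof -
          have "1 + D * q ^ k > 0" using ND q by (simp add: add_pos_nonneg)
          then show ?thesis by (simp add: aq field_simps)
        qed
        then have "d n = (D - N) * (q ^ n / (1 + D * q ^ n) - q ^ Suc n / (1 + D * q ^ Suc n))"
          by (simp only: d_def right_diff_distrib)
        then show ?thesis using ND by simp
      qed
      then show ?thesis using mobius_increment_expansion[OF q absD] by simp
    qed
    have dw: "d n = (\<Sum>m. w m * (q ^ Suc m) ^ n)" for n
    proof -
      have "(\<lambda>m. w m * (q ^ Suc m) ^ n) = (\<lambda>m. (D - N) * ((1 - q ^ Suc m) * (- D) ^ m * q ^ (Suc m * n)))"
        by (simp only: w_def mult.assoc power_mult)
      then show ?thesis using sums_mult[OF expansion[of n], of "D - N"] ND by (simp add: sums_iff)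
    qed
    have rep: "signed_hausdorff_rep \<sigma> d"
    proof -
      have \<sigma>_eq: "\<sigma> = (\<lambda>A. \<Sum>m. w m * indicator A (q ^ Suc m))" by (rule ext) (rule \<sigma>w)
      have d_eq: "d = (\<lambda>n. \<Sum>m. w m * (q ^ Suc m) ^ n)" by (rule ext) (rule dw)
      have "q ^ Suc m \<in> {0..1}" for m using q power_le_one[of q "Suc m"] by simp
      then show ?thesis unfolding \<sigma>_eq d_eq by (rule signed_hausdorff_rep_discrete[OF w])
    qed
    have atom: "\<sigma> {q\<^sup>2} = w 1"
    proof -
      have iff: "q ^ Suc m \<in> {q\<^sup>2} \<longleftrightarrow> m = 1" for m
        using q power_inject_exp'[of q "Suc m" 2] by auto
      have "w m * indicator {q\<^sup>2} (q ^ Suc m) = (if m = 1 then w 1 else 0)" for m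
        unfolding indicator_def iff by simp
      then have "(\<lambda>m. w m * indicator {q\<^sup>2} (q ^ Suc m)) = (\<lambda>m. if m = 1 then w 1 else 0)" ..
      then show ?thesis unfolding \<sigma>w using sums_single[of 1 "\<lambda>_. w 1"] by (simp add: sums_iff)
    qed
    have w1: "w 1 = - (D - N) * D * (1 - q\<^sup>2)" by (simp add: w_def power2_eq_square algebra_simps)
    have "0 < (D - N) * D * (1 - q\<^sup>2)"
      using ND q by (intro mult_pos_pos) (auto simp: power_less_one_iff)
    then have neg: "w 1 < 0" using w1 by linarith
    have "\<nexists>G. bernstein_interpolant G a"
      using no_bernstein_interpolant_negative_atom[OF q w _ neg] dw by (auto simp: d_def)
    moreover have "summable (\<lambda>m. (1 - q ^ Suc m) * (- D) ^ m * q ^ (Suc m * n))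
            \<and> d n = (D - N) * (\<Sum>m. (1 - q ^ Suc m) * (- D) ^ m * q ^ (Suc m * n))" for n
      using expansion[of n] ND by (simp add: sums_iff)
    ultimately show ?thesis
      using rep signed_hausdorff_rep_unique[OF rep] atom w1 neg by simp
  qed

  have iv: "(\<forall>m n. m < n \<longrightarrow> a n < a m) \<and> (\<nexists>G. bernstein_interpolant G a)" if "N > D"
  proof -
    have decr: "a n < a m" if "m < n" for m n
    proof -
      have "p ^ m < p ^ n" using p that by (rule power_strict_increasing[rotated])
      then show ?thesis using pD[of m] pD[of n] \<open>N > D\<close>
        unfolding a_diff by (intro add_strict_left_mono divide_strict_left_mono mult_pos_pos) auto
    qed
    have "a 2 < a 1" by (rule decr) simp
    then have "\<not> bernstein_interpolant G a" for G
      using bernstein_interpolant_mono[of G a 0] by (auto simp: numeral_2_eq_2)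
    with decr show ?thesis by blast
  qed

  have iff: "(\<exists>G. bernstein_interpolant G a) \<longleftrightarrow> N = D \<or> (N < D \<and> D \<le> 0)"
  proof (intro iffI)
    assume G: "\<exists>G. bernstein_interpolant G a"
    consider "N = D" | "N > D" | "N < D" "D \<le> 0" | "N < D" "0 < D" by linarith
    then show "N = D \<or> (N < D \<and> D \<le> 0)"
    proof cases
      case 2
      then show ?thesis using iv G by blast
    next
      case 4
      then show ?thesis using conjunct1[OF iii] G by blast
    qed simp_all
  next
    assume "N = D \<or> (N < D \<and> D \<le> 0)"
    then show "\<exists>G. bernstein_interpolant G a"
      using conjunct2[OF i] conjunct1[OF ii] by blast
  qed
  show ?thesis
    by (rule conjI[OF iff conjI[OF impI[OF i] conjI[OF impI conjI[OF impI impI[OF iv]]]]])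
      (assumption | (elim conjE, rule ii, assumption+) | (elim conjE, rule iii, assumption+))+
qed

end
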